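(* Let $(\Sigma,\varepsilon)$ be an oriented signed graph and let $W$ be a minimal Eulerian walk with a direction $\varepsilon_W$. Then $\Sigma(W)$ is an Eulerian cycle-tree $T$, $W$ uses each edge of the block cycles of $T$ once and each edge of the block paths of $T$ twice, and $\varepsilon_W$ induces a direction $\varepsilon_T$ on $T$. Moreover, \[ f_{(W,\varepsilon_W)}=[\varepsilon,\varepsilon_T]\cdot I_T. \]
   Context: Signed graph $\Sigma=(V,E,\sigma)$: finite graph (loops, multiple edges allowed), $\sigma:E\to\{\pm1\}$. A cycle is a simple closed path (a loop is a cycle); balanced if its edge-sign product is $+1$, else unbalanced. Orientation: $\varepsilon(v,e)\in\{\pm1\}$ for $v$ an end-vertex of $e$, $0$ otherwise, with $\varepsilon(u,e)\varepsilon(v,e)=-\sigma(e)$ for $e=uv$; $+1$ = arrow away from $v$. Sink (source): all arrows at the vertex point toward (away from) it. Coupling: $[\varepsilon_1,\varepsilon_2](e)=\varepsilon_1(v,e)\varepsilon_2(v,e)$ ($v$ an end-vertex) if $e$ lies in the domains of both, $0$ otherwise. Walk $W=u_0x_1u_1\cdots x_nu_n$; sign $\prod\sigma(x_i)$; regarded as edge multiset; $\Sigma(W)$ the signed subgraph of its edges. Direction: $\pm1$ on pairs $(u_{i-1},x_i),(u_i,x_i)$ with $\varepsilon_W(u_{i-1},x_i)\varepsilon_W(u_i,x_i)=-\sigma(x_i)$, $\varepsilon_W(u_i,x_i)+\varepsilon_W(u_i,x_{i+1})=0$ (and $\varepsilon_W(u_0,x_1)+\varepsilon_W(u_n,x_n)=0$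 for closed walks). Eulerian walk: closed walk of sign $+1$ whose directions give the same orientation to all repeated occurrences of each edge; minimal: no Eulerian walk properly contained in it as edge multisets. Characteristic vector: $f_{(W,\varepsilon_W)}(x)=\sum_{i:x_i=x}\varepsilon(v,x)\varepsilon_W(v,x_i)$. Cycle-tree: connected signed subgraph $T$ decomposed into edge-disjoint cycles (block cycles) and vertex-disjoint simple paths (block paths, possibly of length zero) such that the block cycles are all the cycles of $T$, two block cycles share at most one vertex (intersection vertex), each block path meets exactly two block cycles exactly at its two ends (intersection vertices), and every intersection vertex is a cut-point (vertex whose removal increases the number of components) of $T$. Eulerian: each balanced block cycle has an even number, each unbalanced one an odd number, of intersection vertices. Direction of $T$: orientation $\varepsilon_T$ of $T$ with no sink and no source, such that for each block cycle $C$ the restriction to $C$ has a sink or source at each cut-point of $T$ on $C$. $I_T:E\to\mathbb Z$ is $1$ on block-cycle edges, $2$ on block-path edges, $0$ elsewhere.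
   Formalization: Removing a vertex is taken topologically: each loop at it counts as a further component, as two negative loops at one vertex refute the literal claim. Signs of orientations are placed on half-edges, so that positive loops can be oriented, and Eulerian walks have positive length. *)

theory Defs
  imports "HOL-Library.Multiset"
begin

section \<open>Signed graphs\<close>

text \<open>
  Undirected multigraphs with loops. Every edge \<open>x\<close> has two half-edges, labelled by the
  Booleans; \<open>endv G x b\<close> is the vertex at the half-edge \<open>b\<close> of \<open>x\<close>, and \<open>x\<close> is a loop iff both
  vertices agree. The labelling carries no orientation. Half-edges, rather than pairs of a vertex
  and an edge, are needed to speak about loops: the two ends of an oriented positive loop carry
  opposite signs at one and the same vertex.
\<close>

record ('v, 'e) signed_graph =
  verts :: "'v set"
  edges :: "'e set"
  endv :: "'e \<Rightarrow> bool \<Rightarrow> 'v"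
  esign :: "'e \<Rightarrow> int"

definition wf_signed_graph :: "('v, 'e) signed_graph \<Rightarrow> bool" where
  "wf_signed_graph G \<longleftrightarrow> finite (verts G) \<and> finite (edges G) \<and>
     (\<forall>x\<in>edges G. (\<forall>b. endv G x b \<in> verts G) \<and> esign G x \<in> {1, -1})"

definition signed_subgraph :: "('v, 'e) signed_graph \<Rightarrow> ('v, 'e) signed_graph \<Rightarrow> bool" where
  "signed_subgraph H G \<longleftrightarrow> wf_signed_graph H \<and> verts H \<subseteq> verts G \<and> edges H \<subseteq> edges G \<and>
     (\<forall>x\<in>edges H. endv H x = endv G x \<and> esign H x = esign G x)"

definition vertices_of :: "('v, 'e) signed_graph \<Rightarrow> 'e set \<Rightarrow> 'v set" where
  "vertices_of G S = {endv G x b | x b. x \<in> S}"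

section \<open>Walks, connectedness, cycles\<close>

text \<open>
  The walk \<open>u\<^sub>0 x\<^sub>1 u\<^sub>1 \<dots> x\<^sub>n u\<^sub>n\<close> is given by \<open>u\<^sub>0\<close> and the list of pairs \<open>(x\<^sub>i, b\<^sub>i)\<close>, where the walk
  leaves \<open>u\<^bsub>i-1\<^esub>\<close> through the half-edge \<open>b\<^sub>i\<close> of \<open>x\<^sub>i\<close> and enters \<open>u\<^sub>i\<close> through the half-edge \<open>\<not> b\<^sub>i\<close>.
  List positions start at 0, so \<open>x\<^sub>i\<close> sits at position \<open>i - 1\<close>.
\<close>

fun walk :: "('v, 'e) signed_graph \<Rightarrow> 'v \<Rightarrow> ('e \<times> bool) list \<Rightarrow> 'v \<Rightarrow> bool" where
  "walk G u [] v \<longleftrightarrow> u \<in> verts G \<and> u = v"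
| "walk G u ((x, b) # p) v \<longleftrightarrow> x \<in> edges G \<and> endv G x b = u \<and> walk G (endv G x (\<not> b)) p v"

definition walk_verts :: "('v, 'e) signed_graph \<Rightarrow> 'v \<Rightarrow> ('e \<times> bool) list \<Rightarrow> 'v list" where
  "walk_verts G u p = u # map (\<lambda>(x, b). endv G x (\<not> b)) p"

definition walk_edges :: "('e \<times> bool) list \<Rightarrow> 'e list" where
  "walk_edges p = map fst p"

definition walk_sign :: "('v, 'e) signed_graph \<Rightarrow> ('e \<times> bool) list \<Rightarrow> int" where
  "walk_sign G p = prod_list (map (esign G) (walk_edges p))"

definition walk_subgraph ::
    "('v, 'e) signed_graph \<Rightarrow> 'v \<Rightarrow> ('e \<times> bool) list \<Rightarrow> ('v, 'e) signed_graph" where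
  "walk_subgraph G u p = G\<lparr>verts := set (walk_verts G u p), edges := set (walk_edges p)\<rparr>"

definition simple_path :: "('v, 'e) signed_graph \<Rightarrow> 'v \<Rightarrow> ('e \<times> bool) list \<Rightarrow> 'v \<Rightarrow> bool" where
  "simple_path G u p v \<longleftrightarrow> walk G u p v \<and> distinct (walk_verts G u p)"

text \<open>
  A cycle is identified with its edge set. Distinctness of the edges only serves to exclude
  closed walks of length two that traverse the same edge back and forth.
\<close>

definition simple_closed_path :: "('v, 'e) signed_graph \<Rightarrow> 'v \<Rightarrow> ('e \<times> bool) list \<Rightarrow> bool" where
  "simple_closed_path G u p \<longleftrightarrow> p \<noteq> [] \<and> walk G u p u \<and>
     distinct (tl (walk_verts G u p)) \<and> distinct (walk_edges p)"

definition is_cycle :: "('v, 'e) signed_graph \<Rightarrow> 'e set \<Rightarrow> bool" where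
  "is_cycle G C \<longleftrightarrow> (\<exists>u p. simple_closed_path G u p \<and> C = set (walk_edges p))"

definition balanced :: "('v, 'e) signed_graph \<Rightarrow> 'e set \<Rightarrow> bool" where
  "balanced G C \<longleftrightarrow> (\<Prod>x\<in>C. esign G x) = 1"

definition components :: "('v, 'e) signed_graph \<Rightarrow> 'v set set" where
  "components G = verts G // {(u, v). \<exists>p. walk G u p v}"

definition connected_graph :: "('v, 'e) signed_graph \<Rightarrow> bool" where
  "connected_graph G \<longleftrightarrow> verts G \<noteq> {} \<and> (\<forall>u\<in>verts G. \<forall>v\<in>verts G. \<exists>p. walk G u p v)"

definition delete_vertex :: "('v, 'e) signed_graph \<Rightarrow> 'v \<Rightarrow> ('v, 'e) signed_graph" where
  "delete_vertex G v =
     G\<lparr>verts := verts G - {v}, edges := {x \<in> edges G. \<forall>b. endv G x b \<noteq> v}\<rparr>"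

definition loops_at :: "('v, 'e) signed_graph \<Rightarrow> 'v \<Rightarrow> 'e set" where
  "loops_at G v = {x \<in> edges G. \<forall>b. endv G x b = v}"

text \<open>
  A cut-point is a vertex whose removal increases the number of components. Removal is that of a
  point from the graph as a topological space: a loop at \<open>v\<close> becomes an open arc, which is a
  component of its own, whereas every other edge at \<open>v\<close> stays attached to its other end. So the
  common vertex of two loops is a cut-point, as is the base of a loop that meets further edges.
  Where there is no loop at \<open>v\<close>, this is ordinary vertex deletion.
\<close>

definition cut_point :: "('v, 'e) signed_graph \<Rightarrow> 'v \<Rightarrow> bool" where
  "cut_point G v \<longleftrightarrow> v \<in> verts G \<and>
     card (components G) < card (components (delete_vertex G v)) + card (loops_at G v)"

section \<open>Orientations and walk directions\<close>

text \<open>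
  \<open>\<epsilon> x b\<close> is the sign at the half-edge \<open>b\<close> of \<open>x\<close>; the value 1 is an arrow pointing away from
  the vertex \<open>endv G x b\<close>.
\<close>

definition orientation :: "('v, 'e) signed_graph \<Rightarrow> ('e \<Rightarrow> bool \<Rightarrow> int) \<Rightarrow> bool" where
  "orientation G \<epsilon> \<longleftrightarrow>
     (\<forall>x\<in>edges G. (\<forall>b. \<epsilon> x b \<in> {1, -1}) \<and> \<epsilon> x False * \<epsilon> x True = - esign G x) \<and>
     (\<forall>x. x \<notin> edges G \<longrightarrow> (\<forall>b. \<epsilon> x b = 0))"

definition sink :: "('v, 'e) signed_graph \<Rightarrow> 'e set \<Rightarrow> ('e \<Rightarrow> bool \<Rightarrow> int) \<Rightarrow> 'v \<Rightarrow> bool" where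
  "sink G S \<epsilon> v \<longleftrightarrow> (\<forall>x\<in>S. \<forall>b. endv G x b = v \<longrightarrow> \<epsilon> x b = -1)"

definition source :: "('v, 'e) signed_graph \<Rightarrow> 'e set \<Rightarrow> ('e \<Rightarrow> bool \<Rightarrow> int) \<Rightarrow> 'v \<Rightarrow> bool" where
  "source G S \<epsilon> v \<longleftrightarrow> (\<forall>x\<in>S. \<forall>b. endv G x b = v \<longrightarrow> \<epsilon> x b = 1)"

text \<open>
  The coupling of an orientation of \<open>G\<close> with one of \<open>H\<close>, subgraphs of the same signed graph.
  Either half-edge may be used, see \<open>coupling_eq\<close>.
\<close>

definition coupling ::
    "('v, 'e) signed_graph \<Rightarrow> ('e \<Rightarrow> bool \<Rightarrow> int) \<Rightarrow> ('v, 'e) signed_graph \<Rightarrow> ('e \<Rightarrow> bool \<Rightarrow> int) \<Rightarrow>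
     'e \<Rightarrow> int" where
  "coupling G \<epsilon> H \<delta> x = (if x \<in> edges G \<inter> edges H then \<epsilon> x False * \<delta> x False else 0)"

lemma coupling_eq:
  assumes "orientation G \<epsilon>" "orientation H \<delta>" "x \<in> edges G" "x \<in> edges H" "esign G x = esign H x"
  shows "coupling G \<epsilon> H \<delta> x = \<epsilon> x b * \<delta> x b"
proof -
  have "\<epsilon> x False * \<epsilon> x True = \<delta> x False * \<delta> x True"
    "\<epsilon> x c \<in> {1, -1}" "\<delta> x c \<in> {1, -1}" for c
    using assms by (auto simp: orientation_def)
  from this(1) this(2,3)[of False] this(2,3)[of True] show ?thesis
    using assms by (cases b) (auto simp: coupling_def)
qed

text \<open>
  \<open>\<omega> i c\<close> is the sign given to the half-edge \<open>c\<close> of the edge at position \<open>i\<close>. Thus, when \<open>(x, b)\<close>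
  is at position \<open>i\<close>, the walk leaves along \<open>x\<close> with sign \<open>\<omega> i b\<close> and arrives with sign \<open>\<omega> i (\<not> b)\<close>.
\<close>

definition walk_direction ::
    "('v, 'e) signed_graph \<Rightarrow> 'v \<Rightarrow> ('e \<times> bool) list \<Rightarrow> (nat \<Rightarrow> bool \<Rightarrow> int) \<Rightarrow> bool" where
  "walk_direction G u p \<omega> \<longleftrightarrow>
     (\<forall>i<length p. (\<forall>c. \<omega> i c \<in> {1, -1}) \<and> \<omega> i False * \<omega> i True = - esign G (fst (p ! i))) \<and>
     (\<forall>i. Suc i < length p \<longrightarrow> \<omega> i (\<not> snd (p ! i)) + \<omega> (Suc i) (snd (p ! Suc i)) = 0) \<and>
     (p \<noteq> [] \<and> walk G u p u \<longrightarrow>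
        \<omega> 0 (snd (p ! 0)) + \<omega> (length p - 1) (\<not> snd (p ! (length p - 1))) = 0)"

text \<open>
  Eulerian walks are nontrivial; otherwise the trivial walk would be properly contained in all
  others.
\<close>

definition eulerian_walk :: "('v, 'e) signed_graph \<Rightarrow> 'v \<Rightarrow> ('e \<times> bool) list \<Rightarrow> bool" where
  "eulerian_walk G u p \<longleftrightarrow> p \<noteq> [] \<and> walk G u p u \<and> walk_sign G p = 1 \<and>
     (\<forall>\<omega>. walk_direction G u p \<omega> \<longrightarrow>
        (\<forall>i<length p. \<forall>j<length p. fst (p ! i) = fst (p ! j) \<longrightarrow> (\<forall>c. \<omega> i c = \<omega> j c)))"

definition minimal_eulerian_walk :: "('v, 'e) signed_graph \<Rightarrow> 'v \<Rightarrow> ('e \<times> bool) list \<Rightarrow> bool" where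
  "minimal_eulerian_walk G u p \<longleftrightarrow> eulerian_walk G u p \<and>
     \<not> (\<exists>u' p'. eulerian_walk G u' p' \<and> mset (walk_edges p') \<subset># mset (walk_edges p))"

text \<open>
  The summand does not depend on the end of \<open>x\<close> at which it is evaluated; here it is the end by
  which the walk leaves.
\<close>

definition char_vector ::
    "('e \<Rightarrow> bool \<Rightarrow> int) \<Rightarrow> ('e \<times> bool) list \<Rightarrow> (nat \<Rightarrow> bool \<Rightarrow> int) \<Rightarrow> 'e \<Rightarrow> int" where
  "char_vector \<epsilon> p \<omega> x =
     (\<Sum>i\<in>{i. i < length p \<and> fst (p ! i) = x}. \<epsilon> x (snd (p ! i)) * \<omega> i (snd (p ! i)))"

definition induces_orientation ::
    "('e \<times> bool) list \<Rightarrow> (nat \<Rightarrow> bool \<Rightarrow> int) \<Rightarrow> ('e \<Rightarrow> bool \<Rightarrow> int) \<Rightarrow> bool" where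
  "induces_orientation p \<omega> \<tau> \<longleftrightarrow> (\<forall>i<length p. \<forall>c. \<tau> (fst (p ! i)) c = \<omega> i c)"

section \<open>Cycle-trees\<close>

text \<open>
  \<open>\<C>\<close> is the set of block cycles, as edge sets. A block path is a pair of a start vertex and a
  list of traversed edges, so that block paths of length zero can be represented.
\<close>

definition path_verts :: "('v, 'e) signed_graph \<Rightarrow> 'v \<times> ('e \<times> bool) list \<Rightarrow> 'v set" where
  "path_verts G P = set (walk_verts G (fst P) (snd P))"

definition path_ends :: "('v, 'e) signed_graph \<Rightarrow> 'v \<times> ('e \<times> bool) list \<Rightarrow> 'v set" where
  "path_ends G P = {fst P, last (walk_verts G (fst P) (snd P))}"

definition path_edges :: "'v \<times> ('e \<times> bool) list \<Rightarrow> 'e set" where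
  "path_edges P = set (walk_edges (snd P))"

definition block_cycle_edges :: "'e set set \<Rightarrow> 'e set" where
  "block_cycle_edges \<C> = \<Union>\<C>"

definition block_path_edges :: "('v \<times> ('e \<times> bool) list) set \<Rightarrow> 'e set" where
  "block_path_edges \<P> = (\<Union>P\<in>\<P>. path_edges P)"

definition intersection_vertices ::
    "('v, 'e) signed_graph \<Rightarrow> 'e set set \<Rightarrow> ('v \<times> ('e \<times> bool) list) set \<Rightarrow> 'v set" where
  "intersection_vertices T \<C> \<P> =
     {v. \<exists>C\<in>\<C>. \<exists>D\<in>\<C>. C \<noteq> D \<and> v \<in> vertices_of T C \<inter> vertices_of T D} \<union> (\<Union>P\<in>\<P>. path_ends T P)"

definition cycle_tree ::
    "('v, 'e) signed_graph \<Rightarrow> ('v, 'e) signed_graph \<Rightarrow> 'e set set \<Rightarrow>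
     ('v \<times> ('e \<times> bool) list) set \<Rightarrow> bool" where
  "cycle_tree G T \<C> \<P> \<longleftrightarrow>
     signed_subgraph T G \<and> connected_graph T \<and>
     verts T = (\<Union>C\<in>\<C>. vertices_of T C) \<union> (\<Union>P\<in>\<P>. path_verts T P) \<and>
     edges T = block_cycle_edges \<C> \<union> block_path_edges \<P> \<and>
     block_cycle_edges \<C> \<inter> block_path_edges \<P> = {} \<and>
     (\<forall>C\<in>\<C>. \<forall>D\<in>\<C>. C \<noteq> D \<longrightarrow> C \<inter> D = {}) \<and>
     (\<forall>P\<in>\<P>. \<forall>Q\<in>\<P>. P \<noteq> Q \<longrightarrow> path_verts T P \<inter> path_verts T Q = {}) \<and>
     \<C> = {C. is_cycle T C} \<and>
     (\<forall>C\<in>\<C>. \<forall>D\<in>\<C>. C \<noteq> D \<longrightarrow> card (vertices_of T C \<inter> vertices_of T D) \<le> 1) \<and>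
     (\<forall>(u, p)\<in>\<P>. \<exists>v. simple_path T u p v \<and>
        (\<exists>C D. C \<noteq> D \<and>
           {B \<in> \<C>. path_verts T (u, p) \<inter> vertices_of T B \<noteq> {}} = {C, D} \<and>
           path_verts T (u, p) \<inter> vertices_of T C = {u} \<and>
           path_verts T (u, p) \<inter> vertices_of T D = {v})) \<and>
     (\<forall>v\<in>intersection_vertices T \<C> \<P>. cut_point T v)"

definition eulerian_cycle_tree ::
    "('v, 'e) signed_graph \<Rightarrow> ('v, 'e) signed_graph \<Rightarrow> 'e set set \<Rightarrow>
     ('v \<times> ('e \<times> bool) list) set \<Rightarrow> bool" where
  "eulerian_cycle_tree G T \<C> \<P> \<longleftrightarrow> cycle_tree G T \<C> \<P> \<and>
     (\<forall>C\<in>\<C>. if balanced T C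
        then even (card (vertices_of T C \<inter> intersection_vertices T \<C> \<P>))
        else odd (card (vertices_of T C \<inter> intersection_vertices T \<C> \<P>)))"

definition cycle_tree_direction ::
    "('v, 'e) signed_graph \<Rightarrow> 'e set set \<Rightarrow> ('e \<Rightarrow> bool \<Rightarrow> int) \<Rightarrow> bool" where
  "cycle_tree_direction T \<C> \<tau> \<longleftrightarrow> orientation T \<tau> \<and>
     (\<forall>v\<in>verts T. \<not> sink T (edges T) \<tau> v \<and> \<not> source T (edges T) \<tau> v) \<and>
     (\<forall>C\<in>\<C>. \<forall>v\<in>vertices_of T C. cut_point T v \<longrightarrow> sink T C \<tau> v \<or> source T C \<tau> v)"

definition tree_indicator :: "'e set set \<Rightarrow> ('v \<times> ('e \<times> bool) list) set \<Rightarrow> 'e \<Rightarrow> int" where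
  "tree_indicator \<C> \<P> x =
     (if x \<in> block_cycle_edges \<C> then 1 else if x \<in> block_path_edges \<P> then 2 else 0)"

end

theory Submission
  imports Defs "HOL-Combinatorics.Orbits"
begin

text \<open>
  A directed walk is a walk in the digraph on pairs of a vertex and a sign, and minimality forbids
  visiting such a pair twice; hence a vertex is visited at most twice, with opposite signs, and an
  edge is used at most twice, in opposite directions. If the visits of two vertices interlaced,
  reversing a part of the walk would produce a shorter Eulerian walk. So, on the polygon of the
  positions of the walk, the chords joining the two visits of a vertex do not cross. The chords cut
  the polygon into faces: the orbits of the permutation that goes to the next position and then
  jumps along the chord there, if any. A face is a block cycle, except for those made of the two
  traversals of a doubled edge, which line up in block paths. Chords separate the graph, so the
  cut-points are the vertices visited twice, and every cycle lies in one face.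
\<close>

section \<open>Noncrossing cyclic sequences\<close>

text \<open>A position \<open>i\<close> stands both for a visit to the vertex \<open>u i\<close> and
  for the edge leaving from it; thus chords join positions while faces consist of edges. All
  separation statements rest on one fact: a face never crosses a chord. Edge labels, half-edges and
  signs come in only afterwards; signs count chords, since the two visits to a vertex have opposite
  signs, and this gives the parity condition. The obstacle is the doubled edges. Their faces have
  two positions but only one edge, so the faces do not show how such edges line up. Block paths are
  therefore collected along \<open>nxt\<close> instead of \<open>turn\<close>, as maximal runs, and
  a run has to be kept from bending back into its own reversed copy.\<close>

locale noncrossing_cyclic =
  fixes n :: nat and u :: "nat \<Rightarrow> 'v"
  assumes n_pos: "0 < n"
    and at_most_twice: "\<lbrakk>i < n; j < n; k < n; u i = u j; u j = u k\<rbrakk> \<Longrightarrow> i = j \<or> j = k \<or> i = k"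
    and noncrossing: "\<lbrakk>i < k; k < j; j < l; l < n; u i = u j; u k = u l\<rbrakk> \<Longrightarrow> False"
begin

text \<open>Outside \<open>{..<n}\<close> the argument is returned, so that \<open>nxt\<close> is a
  permutation in the sense of \<open>permutes\<close>; the same convention holds for
  \<open>mate\<close>.\<close>

definition nxt :: "nat \<Rightarrow> nat" where
  "nxt i = (if Suc i < n then Suc i else if Suc i = n then 0 else i)"

definition mate :: "nat \<Rightarrow> nat" where
  "mate i = (if i < n \<and> (\<exists>j<n. j \<noteq> i \<and> u j = u i) then SOME j. j < n \<and> j \<noteq> i \<and> u j = u i else i)"

definition turn :: "nat \<Rightarrow> nat" where
  "turn i = mate (nxt i)"

abbreviation face :: "nat \<Rightarrow> nat set" where
  "face \<equiv> orbit turn"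

text \<open>The edge positions on one side of the chord between \<open>i\<close> and \<open>mate i\<close>, starting at \<open>i\<close>.\<close>

definition side :: "nat \<Rightarrow> nat set" where
  "side i = (if i < mate i then {i..<mate i} else {..<n} - {mate i..<i})"

section \<open>The successor permutation and the chord involution\<close>

lemma nxt_less [simp]: "i < n \<Longrightarrow> nxt i < n"
  by (auto simp: nxt_def)

lemma nxt_inj: "nxt i = nxt j \<Longrightarrow> i = j"
  using n_pos by (auto simp: nxt_def split: if_splits)

lemma nxt_permutes: "nxt permutes {..<n}"
  by (rule inj_imp_permutes) (auto simp: inj_on_def nxt_def dest: nxt_inj)

lemma nxt_surj: assumes "i < n" obtains j where "j < n" "nxt j = i"
  using nxt_permutes assms by (metis lessThan_iff permutes_def permutes_in_image)

lemma funpow_nxt_less [simp]: "i < n \<Longrightarrow> (nxt ^^ t) i < n"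
  by (induction t) auto

lemma funpow_nxt: "i < n \<Longrightarrow> (nxt ^^ t) i = (i + t) mod n"
proof (induction t)
  case (Suc t)
  have "Suc ((i + t) mod n) \<le> n" using n_pos by (simp add: Suc_leI)
  then show ?case using Suc by (auto simp: nxt_def mod_Suc)
qed simp

lemma nxt_eq_mod: "i < n \<Longrightarrow> nxt i = Suc i mod n"
  using funpow_nxt[of i 1] by simp

lemma nxt_reach: assumes "i < n" "j < n" obtains t where "t < n" "(nxt ^^ t) i = j"
proof
  let ?t = "(j + (n - i)) mod n"
  show "?t < n" using n_pos by simp
  have "(i + ?t) mod n = (i + (j + (n - i))) mod n" by (simp add: mod_simps)
  also have "i + (j + (n - i)) = j + n" using assms by simp
  finally show "(nxt ^^ ?t) i = j" using assms by (simp add: funpow_nxt)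
qed

lemma nxt_fixed: "i < n \<Longrightarrow> nxt i = i \<longleftrightarrow> n = 1"
  by (auto simp: nxt_def)

lemma mate_cases: 
  assumes "i < n" 
  obtains "mate i = i" "\<And>j. j < n \<Longrightarrow> u j = u i \<Longrightarrow> j = i"
   | "mate i < n" "mate i \<noteq> i" "u (mate i) = u i"
proof (cases "\<exists>j<n. j \<noteq> i \<and> u j = u i")
  case True
  then have "mate i < n \<and> mate i \<noteq> i \<and> u (mate i) = u i"
    using assms unfolding mate_def by (simp, metis (mono_tags, lifting) someI_ex)
  then show ?thesis using that by blast
next
  case False
  then have "mate i = i" "\<And>j. j < n \<Longrightarrow> u j = u i \<Longrightarrow> j = i"
    unfolding mate_def by auto
  then show ?thesis by (rule that(1))
qed

lemma mate_less [simp]: "i < n \<Longrightarrow> mate i < n"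
  by (cases i rule: mate_cases) auto

lemma u_mate [simp]: "u (mate i) = u i"
  by (cases "i < n") (cases i rule: mate_cases, auto simp: mate_def)

lemma u_eq_iff: "i < n \<Longrightarrow> j < n \<Longrightarrow> u i = u j \<longleftrightarrow> j = i \<or> j = mate i"
  by (metis at_most_twice mate_cases mate_less u_mate)

lemma mate_mate [simp]: "mate (mate i) = i"
proof (cases "i < n")
  case True
  then show ?thesis
    using u_eq_iff[of i "mate (mate i)"] u_eq_iff[of "mate i" i] by (metis mate_less u_mate)
qed (auto simp: mate_def)

lemma mate_permutes: "mate permutes {..<n}"
proof (rule inj_imp_permutes)
  show "inj_on mate {..<n}" by (metis inj_on_inverseI mate_mate)
  show "mate i = i" if "i \<notin> {..<n}" for i using that by (simp add: mate_def)
qed auto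

lemma mate_eq_iff: "mate i = j \<longleftrightarrow> i = mate j"
  by (metis mate_mate)

section \<open>Faces as orbits\<close>

lemma turn_permutes: "turn permutes {..<n}"
proof -
  have "turn = mate \<circ> nxt" by (auto simp: turn_def)
  then show ?thesis using permutes_compose[OF nxt_permutes mate_permutes] by simp
qed

lemma turn_permutation: "permutation turn"
  using turn_permutes by (auto simp: permutation_permutes)

lemma turn_less [simp]: "i < n \<Longrightarrow> turn i < n"
  by (simp add: turn_def)

lemma turn_inj: "turn i = turn j \<Longrightarrow> i = j"
  using turn_permutes by (metis permutes_def)

lemma u_turn [simp]: "u (turn i) = u (nxt i)"
  by (simp add: turn_def)

lemma mate_turn [simp]: "mate (turn i) = nxt i"
  by (simp add: turn_def)

lemma mate_nxt: "mate (nxt i) = turn i"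
  by (simp add: turn_def)

lemma face_turn: "face (turn i) = face i"
  by (rule permutation_orbit_step[OF turn_permutation])

lemma self_in_face [simp]: "i \<in> face i"
  by (rule permutation_self_in_orbit[OF turn_permutation])

lemma face_eqI: "j \<in> face i \<Longrightarrow> face j = face i"
  by (meson cyclic_on_orbit' orbit_cyclic_eq3 turn_permutation)

lemma face_less: "i < n \<Longrightarrow> j \<in> face i \<Longrightarrow> j < n"
  using permutes_orbit_subset[OF turn_permutes] by auto

lemma in_face_iff: "j \<in> face i \<longleftrightarrow> face j = face i"
  using face_eqI self_in_face by metis

lemma turn_in_face_iff: "turn j \<in> face i \<longleftrightarrow> j \<in> face i"
  by (simp add: in_face_iff face_turn)

lemma finite_face: "finite (face i)"
  by (simp add: finite_orbit)

lemma turn_image_face: "turn ` face i = face i"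
proof -
  have "bij_betw turn (face i) (turn ` face i)"
    by (auto simp: bij_betw_def inj_on_def dest: turn_inj)
  moreover have "turn ` face i \<subseteq> face i" by (auto simp: turn_in_face_iff)
  ultimately show ?thesis
    by (metis bij_betw_same_card card_subset_eq finite_face)
qed

section \<open>Sides of a chord\<close>

lemma mate_between:
  assumes "i < k" "k < mate i" "i < n"
  shows "i < mate k" "mate k < mate i"
proof -
  have n: "mate i < n" using assms by simp
  then have k: "k < n" using assms(2) by linarith
  then have "mate k < n" by simp
  note n = n k this
  have "mate k \<noteq> i" "mate k \<noteq> mate i" using assms by (metis mate_mate order_less_irrefl)+
  moreover have "\<not> mate k < i"
    using noncrossing[of "mate k" i k "mate i"] assms n by auto
  moreover have "\<not> mate i < mate k"
    using noncrossing[of i k "mate i" "mate k"] assms n by auto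
  ultimately show "i < mate k" "mate k < mate i" by auto
qed

lemma side_subset: "i < n \<Longrightarrow> side i \<subseteq> {..<n}"
  by (auto simp: side_def intro: less_trans)

lemma side_mate: "i < n \<Longrightarrow> mate i \<noteq> i \<Longrightarrow> side (mate i) = {..<n} - side i"
  by (auto simp: side_def intro: less_trans)

lemma self_in_side [simp]: "i < n \<Longrightarrow> mate i \<noteq> i \<Longrightarrow> i \<in> side i"
  by (auto simp: side_def)

lemma mate_notin_side [simp]: "i < n \<Longrightarrow> mate i \<noteq> i \<Longrightarrow> mate i \<notin> side i"
  by (auto simp: side_def)

text \<open>From an edge between the ends of a chord, \<open>turn\<close> either reaches the far end
  and is sent back to the near one, or stops at a visit strictly between them, whose mate is there
  too by noncrossing. Injectivity on a finite interval makes this inclusion an equivalence, which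
  passes to the complementary side.\<close>

lemma turn_in_side:
  assumes "i < n" "mate i \<noteq> i" "k < n"
  shows "turn k \<in> side i \<longleftrightarrow> k \<in> side i"
proof -
  have *: "turn j \<in> {h..<mate h}" if h: "h < mate h" "h < n" and j: "j \<in> {h..<mate h}" for h j
  proof -
    have "mate h < n" using h by simp
    then have nj: "nxt j = Suc j" using j by (auto simp: nxt_def)
    show ?thesis
    proof (cases "Suc j = mate h")
      case True
      then show ?thesis using h nj by (simp add: turn_def)
    next
      case False
      then have "h < Suc j" "Suc j < mate h" using j by auto
      from mate_between[OF this h(2)] show ?thesis using nj by (simp add: turn_def)
    qed
  qed
  have img: "turn j \<in> {h..<mate h} \<longleftrightarrow> j \<in> {h..<mate h}" if h: "h < mate h" "h < n" for h j
  proof -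
    have "turn ` {h..<mate h} = {h..<mate h}"
    proof (rule card_subset_eq)
      show "turn ` {h..<mate h} \<subseteq> {h..<mate h}" using *[OF h] by blast
      show "card (turn ` {h..<mate h}) = card {h..<mate h}"
        by (rule card_image) (auto simp: inj_on_def dest: turn_inj)
    qed simp
    then show ?thesis by (metis (no_types, lifting) image_iff turn_inj)
  qed
  show ?thesis
  proof (cases "i < mate i")
    case True
    then show ?thesis using img[OF True] assms by (simp add: side_def)
  next
    case False
    then show ?thesis using img[of "mate i" k] assms by (simp add: side_def)
  qed
qed

lemma face_side:
  assumes "i < n" "mate i \<noteq> i" "k < n" "l \<in> face k"
  shows "l \<in> side i \<longleftrightarrow> k \<in> side i"
  using assms(4)
proof (induction l rule: orbit.induct)
  case base
  then show ?case using turn_in_side assms by simp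
next
  case (step y)
  then show ?case using turn_in_side[of i y] assms face_less by simp
qed

lemma nxt_leaves_side:
  assumes "i < n" "mate i \<noteq> i" "k \<in> side i" "nxt k \<notin> side i"
  shows "nxt k = mate i"
proof -
  have "mate i < n" "k < n" using assms side_subset by auto
  then show ?thesis
    using assms(1-3) assms(4)[unfolded nxt_def]
    by (cases "Suc k < n"; cases "i < mate i") (auto simp: side_def nxt_def simp del: mate_less)
qed

lemma nxt_enters_side:
  assumes "i < n" "mate i \<noteq> i" "k < n" "k \<notin> side i" "nxt k \<in> side i"
  shows "nxt k = i"
  using nxt_leaves_side[of "mate i" k] assms by (simp add: side_mate)

text \<open>\<open>mate k\<close> is \<open>turn\<close> of the predecessor of \<open>k\<close>, and
  \<open>nxt\<close> changes sides only at the ends of the chord. This is noncrossing in a form that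
  ignores where the cyclic order is cut open.\<close>

lemma mate_in_side:
  assumes "i < n" "mate i \<noteq> i" "k < n" "k \<noteq> i" "k \<noteq> mate i"
  shows "mate k \<in> side i \<longleftrightarrow> k \<in> side i"
proof -
  obtain j where j: "j < n" "nxt j = k" using nxt_surj assms by blast
  have "mate k = turn j" using j by (simp add: turn_def)
  then have "mate k \<in> side i \<longleftrightarrow> j \<in> side i" using turn_in_side[OF assms(1,2) j(1)] by simp
  also have "\<dots> \<longleftrightarrow> k \<in> side i"
    using nxt_leaves_side[of i j] nxt_enters_side[of i j] j assms by auto
  finally show ?thesis .
qed

text \<open>The two ends of a chord belong to different sides, and a face keeps to one side. Hence
  no face contains both visits to a vertex.\<close>

lemma face_mate_neq: 
  assumes "i < n" "mate i \<noteq> i" shows "face (mate i) \<noteq> face i"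
  using face_side[OF assms assms(1), of "mate i"] assms in_face_iff by auto

lemma inj_on_face: "i < n \<Longrightarrow> inj_on u (face i)"
  unfolding inj_on_def using face_mate_neq u_eq_iff face_less face_eqI by metis

text \<open>The two visits \<open>a\<close> and \<open>mate a\<close> to a shared vertex lie in the
  two faces, which are therefore on different sides of that chord; the chord of a second shared
  vertex would have to cross it.\<close>

lemma distinct_faces_common_vertex:
  assumes "i < n" "j < n" "face i \<noteq> face j" "v \<in> u ` face i" "w \<in> u ` face j" 
    "v \<in> u ` face j" "w \<in> u ` face i"
  shows "v = w"
proof -
  obtain a where a: "a \<in> face i" "v = u a" using assms by auto
  obtain b where b: "b \<in> face i" "w = u b" using assms by auto
  have lt: "a < n" "b < n" using a b assms face_less by auto
  have fa: "face a = face i" "face b = face i" using a b face_eqI by auto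
  obtain a' where a': "a' \<in> face j" "v = u a'" using assms by auto
  obtain b' where b': "b' \<in> face j" "w = u b'" using assms by auto
  have lt': "a' < n" "b' < n" using a' b' assms face_less by auto
  have fa': "face a' = face j" "face b' = face j" using a' b' face_eqI by auto
  have m: "a' = mate a" "b' = mate b" using u_eq_iff lt lt' a a' b b' fa fa' assms(3) by metis+
  have ma: "mate a \<noteq> a" using fa fa' m assms(3) by auto
  have "b \<in> side a" using face_side[OF lt(1) ma lt(1), of b] b fa self_in_side[OF lt(1) ma] by simp
  moreover have "mate b \<notin> side a" 
    using face_side[OF lt(1) ma lt'(1), of b'] m fa' in_face_iff mate_notin_side[OF lt(1) ma] by simp
  ultimately have "b = a"
    using mate_in_side[OF lt(1) ma lt(2)] by (metis lt(1) ma mate_notin_side)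
  then show ?thesis using a b by simp
qed

end

lemma funpow_plus: "(f ^^ (a + b)) y = (f ^^ a) ((f ^^ b) y)"
  by (simp add: funpow_add)

section \<open>Doubled edges\<close>

text \<open>Taken for both orders of the two positions, \<open>same_edge\<close> says that the
  traversals of a repeated edge have opposite directions and never follow each other at
  once.\<close>

locale doubled_cyclic = noncrossing_cyclic n u for n :: nat and u :: "nat \<Rightarrow> 'v" +
  fixes x :: "nat \<Rightarrow> 'e"
  assumes same_edge: "\<lbrakk>i < n; j < n; i \<noteq> j; x i = x j\<rbrakk> \<Longrightarrow> u (nxt i) = u j \<and> nxt i \<noteq> j"
begin

definition doubled :: "nat set" where
  "doubled = {i. i < n \<and> (\<exists>j<n. j \<noteq> i \<and> x j = x i)}"

lemma doubled_less: "i \<in> doubled \<Longrightarrow> i < n"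
  by (simp add: doubled_def)

lemma same_edge_turn: "\<lbrakk>i < n; j < n; i \<noteq> j; x i = x j\<rbrakk> \<Longrightarrow> j = turn i"
  using same_edge[of i j] u_eq_iff[of "nxt i" j] unfolding turn_def by (metis nxt_less)

lemma x_eqD: "\<lbrakk>i < n; j < n; x i = x j\<rbrakk> \<Longrightarrow> j = i \<or> i \<in> doubled \<and> j = turn i"
  using same_edge_turn[of i j] by (auto simp: doubled_def)

lemma doubled_turn:
  assumes "i \<in> doubled"
  shows "turn i \<in> doubled" "x (turn i) = x i" "turn i \<noteq> i" "turn (turn i) = i"
    "nxt i \<noteq> turn i" "nxt (turn i) = mate i" "mate i \<noteq> i" "mate (nxt i) \<noteq> nxt i"
proof -
  obtain j where j: "i < n" "j < n" "j \<noteq> i" "x j = x i"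
    using assms by (auto simp: doubled_def)
  have ij: "j = turn i" "i = turn j" using same_edge_turn j by metis+
  show "turn i \<in> doubled" unfolding doubled_def using j ij(1) by (metis (mono_tags, lifting) mem_Collect_eq)
  show "x (turn i) = x i" "turn i \<noteq> i" "turn (turn i) = i" using ij j by metis+
  show "nxt i \<noteq> turn i" using same_edge[of i j] j ij by metis
  then show "mate (nxt i) \<noteq> nxt i" by (simp add: turn_def)
  have "mate (turn j) = nxt j" by simp
  then have mi: "mate i = nxt j" unfolding ij(2)[symmetric] .
  then show "nxt (turn i) = mate i" unfolding ij(1)[symmetric] by (rule sym)
  show "mate i \<noteq> i" using same_edge[of j i] j unfolding mi by simp
qed

lemma turn_doubled_iff: "turn i \<in> doubled \<longleftrightarrow> i \<in> doubled"
  using doubled_turn(1,4) turn_inj by metis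

lemma face_doubled_iff: "j \<in> face i \<Longrightarrow> j \<in> doubled \<longleftrightarrow> i \<in> doubled"
  by (induction j rule: orbit.induct) (auto simp: turn_doubled_iff)

lemma face_doubled: "i \<in> doubled \<Longrightarrow> face i = {i, turn i}"
  using orbit_altdef_bounded[of 2 turn i] doubled_turn(4)[of i]
  by (auto simp: numeral_2_eq_2 less_Suc_eq intro: exI[of _ 0] exI[of _ "Suc 0"])

lemma inj_on_x_face: 
  assumes "i < n" "i \<notin> doubled" shows "inj_on x (face i)"
  using assms x_eqD face_doubled_iff face_less unfolding inj_on_def by metis

text \<open>Reversed copies of consecutive edges follow each other in the opposite order; the
  inductions along a run rest on this step.\<close>

lemma nxt_turn_nxt: "nxt i \<in> doubled \<Longrightarrow> nxt (turn (nxt i)) = turn i"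
  using doubled_turn(6)[of "nxt i"] by (simp add: mate_nxt)

text \<open>
  A run of doubled edges and its reversed copy cannot meet in the middle: there the walk would
  traverse an edge and turn back at once.
\<close>

lemma meet_not_doubled:
  assumes "i \<in> doubled" "(nxt ^^ t) i = turn i"
  shows "\<exists>k. 0 < k \<and> k < t \<and> (nxt ^^ k) i \<notin> doubled"
  using assms
proof (induction t arbitrary: i rule: less_induct)
  case (less t)
  have "t \<noteq> 0" using less.prems doubled_turn(3) by (metis funpow_0)
  moreover have "t \<noteq> 1" using less.prems doubled_turn(5) by auto
  ultimately obtain t' where t': "t = Suc (Suc t')" by (metis One_nat_def not0_implies_Suc)
  show ?case
  proof (cases "nxt i \<in> doubled")
    case True
    \<comment> \<open>Moving both ends inwards by one edge shrinks the gap by two.\<close>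
    have "nxt ((nxt ^^ t') (nxt i)) = nxt (turn (nxt i))"
      using less.prems t' nxt_turn_nxt[OF True] by (simp add: funpow_swap1)
    then have "(nxt ^^ t') (nxt i) = turn (nxt i)" by (rule nxt_inj)
    then obtain k where "0 < k" "k < t'" "(nxt ^^ k) (nxt i) \<notin> doubled"
      using less.IH[OF _ True, of t'] t' by auto
    then show ?thesis using t' by (intro exI[of _ "Suc k"]) (auto simp: funpow_swap1)
  next
    case False
    then show ?thesis using t' by (intro exI[of _ 1]) auto
  qed
qed

section \<open>Maximal runs of doubled edges and their returns\<close>

definition starts :: "nat set" where
  "starts = {i \<in> doubled. \<forall>j\<in>doubled. nxt j \<noteq> i}"

definition run :: "nat \<Rightarrow> nat" where
  "run i = (LEAST r. (nxt ^^ r) i \<notin> doubled)"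

text \<open>The way back begins with the reverse traversal of the last edge of the run, whose index
  is \<open>run i - 1\<close>.\<close>

definition return :: "nat \<Rightarrow> nat" where
  "return i = turn ((nxt ^^ (run i - 1)) i)"

lemma starts_doubled: "i \<in> starts \<Longrightarrow> i \<in> doubled"
  by (simp add: starts_def)

lemma starts_less: "i \<in> starts \<Longrightarrow> i < n"
  by (simp add: starts_doubled doubled_less)

text \<open>Going round from \<open>i\<close> leads to \<open>turn i\<close>, and
  \<open>meet_not_doubled\<close> provides a position on the way. So a run cannot close up, and the
  minimum in \<open>run\<close> exists.\<close>

lemma doubled_eventually_not:
  assumes "i \<in> doubled" obtains r where "(nxt ^^ r) i \<notin> doubled"
proof -
  obtain t where "(nxt ^^ t) i = turn i" using nxt_reach assms doubled_less turn_less by metis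
  then show ?thesis using meet_not_doubled[OF assms] that by blast
qed

lemma run_end: "i \<in> doubled \<Longrightarrow> (nxt ^^ run i) i \<notin> doubled"
  unfolding run_def using doubled_eventually_not by (metis (mono_tags, lifting) LeastI_ex)

lemma run_doubled: "k < run i \<Longrightarrow> (nxt ^^ k) i \<in> doubled"
  unfolding run_def using not_less_Least by blast

lemma run_pos: "i \<in> doubled \<Longrightarrow> 0 < run i"
  using run_end[of i] by (cases "run i") auto

lemma run_eqI:
  assumes "(nxt ^^ r) i \<notin> doubled" "\<And>k. k < r \<Longrightarrow> (nxt ^^ k) i \<in> doubled" 
  shows "run i = r"
  unfolding run_def using assms by (intro Least_equality) (auto simp: not_le[symmetric])

text \<open>\<open>mate i\<close> is \<open>turn\<close> of the predecessor of \<open>i\<close>, and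
  \<open>turn\<close> preserves doubledness. The block cycle at the start of a run is thus the face
  of \<open>mate i\<close>.\<close>

lemma mate_start_not_doubled: 
  assumes "i \<in> starts" shows "mate i \<notin> doubled"
proof -
  obtain j where "j < n" "nxt j = i" using nxt_surj starts_less assms by blast
  then show ?thesis using assms turn_doubled_iff by (auto simp: starts_def simp flip: mate_nxt)
qed

lemma return_funpow:
  assumes "i \<in> doubled" "d < run i"
  shows "(nxt ^^ d) (return i) = turn ((nxt ^^ (run i - 1 - d)) i)"
  using assms(2)
proof (induction d)
  case (Suc d)
  define j where "j = (nxt ^^ (run i - 1 - Suc d)) i"
  have e: "run i - 1 - d = Suc (run i - 1 - Suc d)" using Suc.prems by simp
  then have "nxt j = (nxt ^^ (run i - 1 - d)) i" by (simp add: j_def)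
  moreover have "nxt j \<in> doubled" using run_doubled[of "run i - 1 - d" i] Suc.prems calculation by simp
  ultimately show ?case using Suc nxt_turn_nxt[of j] by (simp add: j_def)
qed (simp add: return_def)

text \<open>A run has one more visit than edges, hence the inclusive bound on \<open>k\<close> and
  the index \<open>run i - k\<close>, where \<open>return_funpow\<close> for edges has
  \<open>run i - 1 - d\<close>.\<close>

lemma mate_run:
  assumes "i \<in> doubled" "k \<le> run i"
  shows "mate ((nxt ^^ k) i) = (nxt ^^ (run i - k)) (return i)"
proof (cases "k = run i")
  case True
  then obtain k' where "run i = Suc k'" using run_pos assms by (metis gr0_implies_Suc)
  then show ?thesis using True by (simp add: return_def mate_nxt)
next
  case False
  then have "k < run i" using assms by simp
  then have "(nxt ^^ (run i - k)) (return i) = nxt ((nxt ^^ (run i - 1 - k)) (return i))"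
    using funpow_plus[of 1 "run i - 1 - k" nxt] Suc_diff_Suc[of k "run i"] by simp
  also have "\<dots> = nxt (turn ((nxt ^^ k) i))"
    using return_funpow[OF assms(1), of "run i - 1 - k"] \<open>k < run i\<close> by simp
  also have "\<dots> = mate ((nxt ^^ k) i)" using doubled_turn(6) run_doubled[OF \<open>k < run i\<close>] by simp
  finally show ?thesis by simp
qed

lemma return_doubled: "i \<in> doubled \<Longrightarrow> return i \<in> doubled"
  using run_pos by (simp add: return_def turn_doubled_iff run_doubled)

lemma run_return:
  assumes "i \<in> starts" shows "run (return i) = run i"
proof (rule run_eqI)
  have i: "i \<in> doubled" using assms starts_doubled by simp
  show "(nxt ^^ run i) (return i) \<notin> doubled"
    using mate_run[OF i, of 0] mate_start_not_doubled[OF assms] by simp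
  show "(nxt ^^ k) (return i) \<in> doubled" if "k < run i" for k
    using return_funpow[OF i that] that by (simp add: turn_doubled_iff run_doubled)
qed

lemma return_starts:
  assumes "i \<in> starts" shows "return i \<in> starts"
proof -
  have i: "i \<in> doubled" using assms starts_doubled by simp
  have "nxt j \<noteq> return i" if "j \<in> doubled" for j
  proof
    assume "nxt j = return i"
    then have "turn j = mate (return i)" by (simp add: turn_def)
    also have "\<dots> = (nxt ^^ run i) i" using mate_run[OF i, of "run i"] mate_eq_iff by simp
    finally show False using run_end[OF i] that turn_doubled_iff by metis
  qed
  then show ?thesis using return_doubled[OF i] by (auto simp: starts_def)
qed

lemma return_return:
  assumes "i \<in> starts" shows "return (return i) = i"
proof -
  have i: "i \<in> doubled" using assms starts_doubled by simp
  have "return (return i) = turn (turn i)"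
    unfolding return_def[of "return i"] run_return[OF assms]
    using return_funpow[OF i, of "run i - 1"] run_pos[OF i] by simp
  then show ?thesis using doubled_turn(4)[OF i] by simp
qed

text \<open>A run equal to its own return would lead from \<open>i\<close> to \<open>turn i\<close>
  through doubled positions only. So \<open>return\<close> is an involution of \<open>starts\<close>
  without fixed points, and one run of each pair can be selected.\<close>

lemma return_neq:
  assumes "i \<in> starts" shows "return i \<noteq> i"
proof
  have i: "i \<in> doubled" using assms starts_doubled by simp
  assume "return i = i"
  then have "(nxt ^^ (run i - 1)) i = turn i"
    unfolding return_def using doubled_turn(4) run_doubled[of "run i - 1" i] run_pos[OF i] by force
  from meet_not_doubled[OF i this] show False using run_doubled[of _ i] by force
qed

text \<open>Cancelling common steps places one start within the other run, or at its end position;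
  unless the starts agree, its predecessor is doubled, which a start forbids.\<close>

lemma run_position_unique:
  assumes "i \<in> starts" "j \<in> starts" "a \<le> run i" "b \<le> run j" "(nxt ^^ a) i = (nxt ^^ b) j"
  shows "i = j \<and> a = b"
proof -
  have *: "i = j \<and> a = b" if "i \<in> starts" "b \<le> run j" "(nxt ^^ a) i = (nxt ^^ b) j" "a \<le> b" for i j a b
  proof -
    have inj: "inj (nxt ^^ a)" by (rule inj_fn, rule injI, rule nxt_inj)
    have "(nxt ^^ b) j = (nxt ^^ a) ((nxt ^^ (b - a)) j)"
      unfolding funpow_plus[symmetric] using \<open>a \<le> b\<close> by simp
    with that(3) have "(nxt ^^ a) i = (nxt ^^ a) ((nxt ^^ (b - a)) j)" by (rule trans)
    then have i: "i = (nxt ^^ (b - a)) j" by (rule injD[OF inj])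
    have "b - a = 0"
    proof (rule ccontr)
      assume "b - a \<noteq> 0"
      then obtain c where c: "b - a = Suc c" by (metis not0_implies_Suc)
      then have "(nxt ^^ c) j \<in> doubled" using that by (intro run_doubled) simp
      moreover have "nxt ((nxt ^^ c) j) = i" unfolding i c by simp
      ultimately show False using \<open>i \<in> starts\<close> by (auto simp: starts_def)
    qed
    then show ?thesis using i \<open>a \<le> b\<close> by simp
  qed
  show ?thesis using *[of i b j a] *[of j a i b] assms by (cases "a \<le> b") auto
qed

text \<open>Visits to the same vertex are equal or mates, and the mates of the visits of a run make
  up its return. Disjointness of the block paths follows.\<close>

lemma run_vertex:
  assumes "i \<in> starts" "j \<in> starts" "a \<le> run i" "b \<le> run j" "u ((nxt ^^ a) i) = u ((nxt ^^ b) j)"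
  shows "j = i \<and> a = b \<or> j = return i"
proof -
  have "(nxt ^^ b) j = (nxt ^^ a) i \<or> (nxt ^^ b) j = mate ((nxt ^^ a) i)"
    using assms u_eq_iff[of "(nxt ^^ a) i" "(nxt ^^ b) j"] starts_less by simp
  then show ?thesis
  proof
    assume "(nxt ^^ b) j = (nxt ^^ a) i"
    then show ?thesis using run_position_unique assms by metis
  next
    assume "(nxt ^^ b) j = mate ((nxt ^^ a) i)"
    then have "(nxt ^^ b) j = (nxt ^^ (run i - a)) (return i)"
      using mate_run assms starts_doubled by simp
    then show ?thesis using run_position_unique[of j "return i" b "run i - a"] assms 
        return_starts run_return by simp
  qed
qed

lemma run_vertex_inj:
  assumes "i \<in> starts" "a \<le> run i" "b \<le> run i" "u ((nxt ^^ a) i) = u ((nxt ^^ b) i)"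
  shows "a = b"
  using run_vertex[of i i a b] assms return_neq[of i] by metis

lemma doubled_in_run:
  assumes "k \<in> doubled"
  obtains i a where "i \<in> starts" "a < run i" "k = (nxt ^^ a) i"
proof -
  define P where "P t l \<longleftrightarrow> l < n \<and> l \<notin> doubled \<and> (nxt ^^ t) l = k" for t l
  obtain r where r: "(nxt ^^ r) k \<notin> doubled" using doubled_eventually_not assms by blast
  have "(nxt ^^ r) k < n" using assms doubled_less by simp
  then obtain t where "(nxt ^^ t) ((nxt ^^ r) k) = k" 
    using nxt_reach assms doubled_less by metis
  then have "\<exists>t l. P t l" using r \<open>(nxt ^^ r) k < n\<close> unfolding P_def by blast
  \<comment> \<open>Going backwards from \<open>k\<close>, the nearest position that is not doubled
    directly precedes the start of the run.\<close>
  define t where "t = (LEAST t. \<exists>l. P t l)"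
  have "\<exists>l. P t l" unfolding t_def using LeastI_ex[OF \<open>\<exists>t l. P t l\<close>] .
  then obtain l where l: "P t l" ..
  have least: "\<not> P s l'" if "s < t" for s l' using that not_less_Least unfolding t_def by blast
  have "t \<noteq> 0" using l assms unfolding P_def by (metis funpow_0)
  then obtain a where a: "t = Suc a" by (metis not0_implies_Suc)
  define i where "i = nxt l"
  have "i < n" using l by (simp add: i_def P_def)
  have k: "k = (nxt ^^ a) i" using l a by (simp add: i_def P_def funpow_swap1)
  have D: "(nxt ^^ b) i \<in> doubled" if "b \<le> a" for b
  proof (rule ccontr)
    assume "(nxt ^^ b) i \<notin> doubled"
    moreover have "(nxt ^^ (a - b)) ((nxt ^^ b) i) = k"
      using k that funpow_plus[of "a - b" b nxt i] by simp
    ultimately have "P (a - b) ((nxt ^^ b) i)" using \<open>i < n\<close> by (simp add: P_def)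
    then show False using least[of "a - b"] a by simp
  qed
  have i: "i \<in> starts" 
    using D[of 0] l nxt_inj unfolding starts_def i_def P_def by auto
  have "a < run i" using run_end[OF starts_doubled[OF i]] D by (meson not_le)
  then show ?thesis using that i k by blast
qed

text \<open>The chord between \<open>nxt i\<close> and \<open>turn i\<close>, at the far end of the
  first edge, separates the ends of the run: the run could leave \<open>side (nxt i)\<close> only at
  \<open>turn i\<close>, where it would meet its reversed copy, whereas \<open>mate i\<close> lies
  on the other side.\<close>

lemma run_end_face:
  assumes "i \<in> starts" shows "face ((nxt ^^ run i) i) \<noteq> face (mate i)"
proof -
  have i: "i \<in> doubled" "i < n" using assms starts_doubled starts_less by auto
  let ?c = "nxt i"
  have c: "?c < n" "mate ?c \<noteq> ?c" using i doubled_turn by auto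
  have in_side: "Suc k \<le> run i \<Longrightarrow> (nxt ^^ Suc k) i \<in> side ?c" for k
  proof (induction k)
    case 0
    then show ?case using c by simp
  next
    case (Suc k)
    show ?case
    proof (rule ccontr)
      assume "(nxt ^^ Suc (Suc k)) i \<notin> side ?c"
      then have "(nxt ^^ Suc (Suc k)) i = turn i" 
        using nxt_leaves_side[OF c, of "(nxt ^^ Suc k) i"] Suc by (simp add: mate_nxt)
      from meet_not_doubled[OF i(1) this] show False
        using Suc.prems run_doubled[of _ i] by (metis less_le_trans)
    qed
  qed
  obtain k where k: "run i = Suc k" using run_pos[OF i(1)] by (metis gr0_implies_Suc)
  have e: "(nxt ^^ run i) i \<in> side ?c" using in_side[of k] k by simp
  have "turn i \<notin> side ?c" using mate_notin_side[OF c] by (simp add: mate_nxt)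
  then have "mate i \<notin> side ?c"
    using nxt_enters_side[OF c, of "turn i"] i doubled_turn(3,6)[OF i(1)] nxt_inj by auto
  then show ?thesis
    using e face_side[OF c, of "mate i" "(nxt ^^ run i) i"] i by (auto simp: in_face_iff)
qed

text \<open>\<open>mate i\<close> is \<open>turn\<close> of the predecessor of \<open>i\<close>, so
  this predecessor is doubled. The lemma recognises, from a block cycle, the vertices where block
  paths are attached.\<close>

lemma run_end_at_mate_doubled:
  assumes "i < n" "i \<notin> doubled" "mate i \<in> doubled"
  obtains j where "j \<in> starts" "i = (nxt ^^ run j) j"
proof -
  obtain p where p: "p < n" "nxt p = i" using nxt_surj assms by blast
  then have "p \<in> doubled" using assms mate_nxt[of p] turn_doubled_iff by simp
  then obtain j a where j: "j \<in> starts" "a < run j" "p = (nxt ^^ a) j" using doubled_in_run by blast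
  then have "i = (nxt ^^ Suc a) j" using p by simp
  moreover then have "Suc a = run j" using j assms run_doubled[of "Suc a" j] by (metis Suc_lessI)
  ultimately show ?thesis using that j by metis
qed

end

section \<open>Walks\<close>

abbreviation arc_start :: "('v, 'e) signed_graph \<Rightarrow> 'e \<times> bool \<Rightarrow> 'v" where
  "arc_start G a \<equiv> endv G (fst a) (snd a)"

abbreviation arc_end :: "('v, 'e) signed_graph \<Rightarrow> 'e \<times> bool \<Rightarrow> 'v" where
  "arc_end G a \<equiv> endv G (fst a) (\<not> snd a)"

lemma walk_Cons: 
  "walk G v (a # p) w \<longleftrightarrow> fst a \<in> edges G \<and> arc_start G a = v \<and> walk G (arc_end G a) p w"
  by (cases a) simp

lemma walk_append: "walk G v p w \<Longrightarrow> walk G w q z \<Longrightarrow> walk G v (p @ q) z"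
  by (induction p arbitrary: v) (auto simp: walk_Cons)

lemma walk_verts_eq: "walk_verts G v p = v # map (arc_end G) p"
  by (simp add: walk_verts_def case_prod_unfold)

text \<open>Used with vertices for plain walks and with pairs of a vertex and a sign for directed
  ones.\<close>

fun chain :: "('a \<Rightarrow> 's) \<Rightarrow> ('a \<Rightarrow> 's) \<Rightarrow> 's \<Rightarrow> 'a list \<Rightarrow> 's \<Rightarrow> bool" where
  "chain f g s [] t \<longleftrightarrow> s = t"
| "chain f g s (a # p) t \<longleftrightarrow> f a = s \<and> chain f g (g a) p t"

lemma chain_append: "chain f g s p t \<Longrightarrow> chain f g t q r \<Longrightarrow> chain f g s (p @ q) r"
  by (induction p arbitrary: s) auto

lemma walk_conv_chain:
  "walk G v p w \<longleftrightarrow> 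
    w \<in> verts G \<and> fst ` set p \<subseteq> edges G \<and> chain (arc_start G) (arc_end G) v p w"
  by (induction p arbitrary: v) (auto simp: walk_Cons)

lemma chain_conv_nth:
  assumes "p \<noteq> []" 
  shows "chain f g s p t \<longleftrightarrow> f (p ! 0) = s \<and>
    (\<forall>k. Suc k < length p \<longrightarrow> g (p ! k) = f (p ! Suc k)) \<and> g (last p) = t"
  using assms
proof (induction p arbitrary: s rule: list_nonempty_induct)
  case (cons a p)
  have "(\<forall>k. Suc k < length (a # p) \<longrightarrow> Q k) \<longleftrightarrow> Q 0 \<and> (\<forall>k. Suc k < length p \<longrightarrow> Q (Suc k))" for Q
    using cons.hyps by (metis Suc_less_eq length_Cons length_greater_0_conv not0_implies_Suc)
  then show ?case using cons by auto
qed auto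

lemma closed_chain_nth:
  assumes "chain f g s p s" "k < length p"
  shows "g (p ! k) = f (p ! (Suc k mod length p))"
proof -
  have ne: "p \<noteq> []" using assms by auto
  note W = assms(1)[unfolded chain_conv_nth[OF ne]]
  show ?thesis
  proof (cases "Suc k < length p")
    case False
    then have "Suc k = length p" using assms by simp
    moreover then have "last p = p ! k" using ne by (simp add: last_conv_nth flip: \<open>Suc k = length p\<close>)
    ultimately show ?thesis using W by simp
  qed (use W in simp)
qed

lemma chain_segment:
  assumes "chain f g s p t" "i < j" "j < length p"
  shows "chain f g (f (p ! i)) (drop i (take j p)) (f (p ! j))"
proof -
  have len: "length (drop i (take j p)) = j - i" using assms by simp
  have nth: "drop i (take j p) ! k = p ! (i + k)" if "k < j - i" for k using that assms by simp
  have ne: "p \<noteq> []" "drop i (take j p) \<noteq> []" using assms by auto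
  note C = assms(1)[unfolded chain_conv_nth[OF ne(1)]]
  have "last (drop i (take j p)) = p ! (j - 1)"
    using assms by (subst last_conv_nth[OF ne(2)]) (simp add: len nth)
  moreover have "g (p ! (j - 1)) = f (p ! j)" using C assms by (cases j) auto
  ultimately show ?thesis
    unfolding chain_conv_nth[OF ne(2)] len using C assms by (auto simp: nth)
qed

lemma chain_reverse:
  assumes "chain f g s p t" "\<And>a. f (h a) = opp (g a)" "\<And>a. g (h a) = opp (f a)"
  shows "chain f g (opp t) (map h (rev p)) (opp s)"
  using assms(1)
proof (induction p arbitrary: s)
  case (Cons a p)
  then have "chain f g (opp t) (map h (rev p)) (opp (g a))" "f a = s" by auto
  then show ?case using assms by (auto intro: chain_append)
qed simp

lemma closed_walk_nth:
  assumes "walk G v p v" "k < length p"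
  shows "fst (p ! k) \<in> edges G" "arc_end G (p ! k) = arc_start G (p ! (Suc k mod length p))"
  using assms closed_chain_nth[of _ _ v p k] by (auto simp: walk_conv_chain)

lemma walk_reverse: 
  assumes "wf_signed_graph G" "walk G v p w" shows "\<exists>q. walk G w q v"
  using assms(2)
proof (induction p arbitrary: v)
  case Nil
  then show ?case by (auto intro: exI[of _ "[]"])
next
  case (Cons a p)
  then obtain q where q: "walk G w q (arc_end G a)" by (auto simp: walk_Cons)
  have "walk G (arc_end G a) [(fst a, \<not> snd a)] v"
    using Cons.prems assms(1) by (auto simp: walk_Cons wf_signed_graph_def)
  then show ?case using walk_append[OF q] by blast
qed

text \<open>Going round from \<open>Suc k\<close> to \<open>k\<close> avoids the step at
  \<open>k\<close>; so nothing changes exactly once around a cycle.\<close>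

lemma cyclic_change:
  assumes "k < L" and "\<And>j. j < L \<Longrightarrow> j \<noteq> k \<Longrightarrow> g j = g (Suc j mod L)"
  shows "g k = g (Suc k mod L)"
proof -
  have "t < L \<Longrightarrow> g ((Suc k + t) mod L) = g (Suc k mod L)" for t
  proof (induction t)
    case (Suc t)
    let ?j = "(Suc k + t) mod L"
    have "?j \<noteq> k"
      using Suc.prems assms(1) by (cases "k + Suc t < L") (auto simp: mod_if)
    then have "g ?j = g (Suc ?j mod L)" using assms by simp
    then show ?case using Suc by (simp add: mod_Suc_eq)
  qed simp
  from this[of "L - 1"] show ?thesis using assms(1) by simp
qed

section \<open>The graph of a noncrossing closed walk\<close>

locale noncrossing_walk = doubled_cyclic n u x
  for n :: nat and u :: "nat \<Rightarrow> 'v" and x :: "nat \<Rightarrow> 'e" +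
  fixes T :: "('v, 'e) signed_graph" and b :: "nat \<Rightarrow> bool"
  assumes wf: "wf_signed_graph T"
    and verts_T: "verts T = u ` {..<n}"
    and edges_T: "edges T = x ` {..<n}"
    and start_T: "i < n \<Longrightarrow> endv T (x i) (b i) = u i"
    and end_T: "i < n \<Longrightarrow> endv T (x i) (\<not> b i) = u (nxt i)"
begin

definition arc :: "nat \<Rightarrow> 'e \<times> bool" where
  "arc i = (x i, b i)"

text \<open>\<open>f\<close> iterates \<open>nxt\<close> for pieces of the given walk and
  \<open>turn\<close> for faces; both yield walks because
  \<open>u (turn i) = u (nxt i)\<close>.\<close>

definition arcs :: "(nat \<Rightarrow> nat) \<Rightarrow> nat \<Rightarrow> ('e \<times> bool) list" where
  "arcs f k = map (\<lambda>t. arc (f t)) [0..<k]"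

lemma edge_end_cases:
  assumes "i < n" 
  obtains "c = b i" "endv T (x i) c = u i" | "c = (\<not> b i)" "endv T (x i) c = u (turn i)"
  using start_T[OF assms] end_T[OF assms] u_turn by (cases "c = b i") auto

lemma walk_verts_arcs:
  assumes "endv H = endv T" "\<And>t. t < k \<Longrightarrow> f t < n \<and> u (f (Suc t)) = u (nxt (f t))"
  shows "walk_verts H (u (f 0)) (arcs f k) = map (\<lambda>t. u (f t)) [0..<Suc k]"
proof -
  have "map (arc_end H) (arcs f k) = map (\<lambda>t. u (f (Suc t))) [0..<k]"
    using assms end_T by (auto simp: arcs_def arc_def)
  then show ?thesis
    unfolding walk_verts_eq upt_conv_Cons[OF zero_less_Suc] map_Suc_upt[symmetric] by simp
qed

lemma walk_arcs:
  assumes "endv H = endv T" 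
    and "\<And>t. t < k \<Longrightarrow> f t < n \<and> x (f t) \<in> edges H \<and> u (f (Suc t)) = u (nxt (f t))"
    and "\<And>t. t \<le> k \<Longrightarrow> u (f t) \<in> verts H"
  shows "walk H (u (f 0)) (arcs f k) (u (f k))"
  using assms(2,3)
proof (induction k)
  case 0
  then show ?case by (simp add: arcs_def)
next
  case (Suc k)
  have "walk H (u (f k)) [arc (f k)] (u (f (Suc k)))"
    using Suc.prems(1)[of k] Suc.prems(2)[of "Suc k"] assms(1) start_T[of "f k"] end_T[of "f k"] 
    by (simp add: arc_def)
  moreover have "walk H (u (f 0)) (arcs f k) (u (f k))" using Suc by simp
  moreover have "arcs f (Suc k) = arcs f k @ [arc (f k)]" by (simp add: arcs_def)
  ultimately show ?case using walk_append by metis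
qed

lemma u_in_verts: "i < n \<Longrightarrow> u i \<in> verts T"
  by (simp add: verts_T)

lemma x_in_edges: "i < n \<Longrightarrow> x i \<in> edges T"
  by (simp add: edges_T)

lemma connected_T: "connected_graph T"
  unfolding connected_graph_def
proof (intro conjI ballI)
  show "verts T \<noteq> {}" using n_pos by (auto simp: verts_T)
next
  fix v w assume "v \<in> verts T" "w \<in> verts T"
  then obtain i j where ij: "i < n" "j < n" "v = u i" "w = u j" by (auto simp: verts_T)
  obtain t where "(nxt ^^ t) i = j" using nxt_reach ij by blast
  then have "walk T (u i) (arcs (\<lambda>t. (nxt ^^ t) i) t) (u j)"
    using walk_arcs[of T t "\<lambda>t. (nxt ^^ t) i"] ij by (auto simp: u_in_verts x_in_edges)
  then show "\<exists>p. walk T v p w" using ij by blast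
qed

section \<open>Faces and cycles\<close>

lemma vertices_of_image: 
  assumes "S \<subseteq> {..<n}" shows "vertices_of T (x ` S) = u ` (S \<union> turn ` S)"
proof -
  have "{endv T (x i) c | c. True} = {u i, u (turn i)}" if "i \<in> S" for i
  proof -
    have "endv T (x i) c \<in> {endv T (x i) (b i), endv T (x i) (\<not> b i)}" for c
      by (cases "c = b i") auto
    then have "{endv T (x i) c | c. True} = {endv T (x i) (b i), endv T (x i) (\<not> b i)}" by blast
    then show ?thesis using assms that start_T end_T by auto
  qed
  moreover have "vertices_of T (x ` S) = (\<Union>i\<in>S. {endv T (x i) c | c. True})"
    by (auto simp: vertices_of_def)
  ultimately show ?thesis by (auto simp del: u_turn)
qed

lemma vertices_of_face: "i < n \<Longrightarrow> vertices_of T (x ` face i) = u ` face i"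
  using face_less by (subst vertices_of_image) (auto simp: turn_image_face turn_in_face_iff)

text \<open>One period of \<open>turn\<close> lists the face. No vertex recurs since
  \<open>u\<close> is injective on a face, and no edge recurs since none is doubled.\<close>

lemma face_is_cycle:
  assumes "i < n" "i \<notin> doubled"
  shows "is_cycle T (x ` face i)"
proof -
  define L where "L = (LEAST L. 0 < L \<and> (turn ^^ L) i = i)"
  have "\<exists>L. 0 < L \<and> (turn ^^ L) i = i"
    using self_in_face[of i] unfolding orbit_altdef by auto
  then have L: "0 < L" "(turn ^^ L) i = i"
    unfolding L_def by (metis (mono_tags, lifting) LeastI_ex)+
  have least: "(turn ^^ k) i \<noteq> i" if "0 < k" "k < L" for k
    using that not_less_Least unfolding L_def by blast
  let ?f = "\<lambda>t. (turn ^^ t) i"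
  have face: "face i = ?f ` {0..<L}" using orbit_altdef_bounded[OF L(2,1)] by auto
  have ne: "?f r \<noteq> ?f t" if "r < t" "t < L" for r t
  proof
    assume "?f r = ?f t"
    then have "?f r = (turn ^^ r) (?f (t - r))" using that funpow_plus[of r "t - r" turn i] by simp
    moreover have "inj (turn ^^ r)" by (rule inj_fn, rule injI, rule turn_inj)
    ultimately have "?f (t - r) = i" by (metis injD)
    then show False using least[of "t - r"] that by simp
  qed
  have inj: "inj_on ?f {0..<L}"
  proof (rule inj_onI)
    fix r t assume "r \<in> {0..<L}" "t \<in> {0..<L}" "?f r = ?f t"
    then show "r = t" using ne[of r t] ne[of t r] by (cases r t rule: linorder_cases) auto
  qed
  have less: "?f t < n" for t using assms(1) by (induction t) auto
  define p where "p = arcs ?f L"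
  have "walk T (u (?f 0)) p (u (?f L))"
    unfolding p_def by (rule walk_arcs) (auto simp: less u_in_verts x_in_edges)
  then have "walk T (u i) p (u i)" using L by simp
  moreover have edges: "walk_edges p = map (\<lambda>t. x (?f t)) [0..<L]"
    by (simp add: p_def arcs_def arc_def walk_edges_def)
  moreover have "distinct (walk_edges p)"
    unfolding edges using inj inj_on_x_face[OF assms] face
    by (auto simp: distinct_map intro: comp_inj_on[unfolded comp_def])
  moreover have "tl (walk_verts T (u i) p) = map (\<lambda>t. u (?f (Suc t))) [0..<L]"
  proof -
    have "walk_verts T (u (?f 0)) p = map (\<lambda>t. u (?f t)) [0..<Suc L]"
      unfolding p_def by (rule walk_verts_arcs) (auto simp: less)
    also have "\<dots> = u i # map (\<lambda>t. u (?f (Suc t))) [0..<L]"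
      unfolding upt_conv_Cons[OF zero_less_Suc] map_Suc_upt[symmetric] by simp
    finally show ?thesis by simp
  qed
  moreover have "distinct (map (\<lambda>t. u (?f (Suc t))) [0..<L])"
  proof -
    have "inj_on (\<lambda>t. u (turn (?f t))) {0..<L}"
    proof (rule inj_onI)
      fix r t assume *: "r \<in> {0..<L}" "t \<in> {0..<L}" "u (turn (?f r)) = u (turn (?f t))"
      then have "?f r \<in> face i" "?f t \<in> face i" using face by auto
      then have "turn (?f r) \<in> face i" "turn (?f t) \<in> face i" by (auto simp only: turn_in_face_iff)
      then have "?f r = ?f t" using inj_on_face[OF assms(1)] * turn_inj by (metis inj_onD)
      then show "r = t" using inj * by (metis inj_onD)
    qed
    then show ?thesis by (simp add: distinct_map)
  qed
  ultimately have "simple_closed_path T (u i) p"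
    using L(1) unfolding simple_closed_path_def by (auto simp: p_def arcs_def)
  moreover have "x ` face i = set (walk_edges p)" by (auto simp: edges face)
  ultimately show ?thesis unfolding is_cycle_def by blast
qed

lemma incident_face:
  assumes "a < n" "i < n" "endv T (x a) c = u i"
  shows "face a = face i \<or> face a = face (mate i)"
  using assms(1)
proof (cases rule: edge_end_cases[of a c])
  case 1
  then show ?thesis using u_eq_iff[of i a] assms by auto
next
  case 2
  then have "turn a = i \<or> turn a = mate i" using u_eq_iff[of i "turn a"] assms by auto
  then show ?thesis using face_turn by metis
qed

text \<open>The visits to a vertex lie on the same side of every chord belonging to another vertex,
  and with them all edges there: the two sides are connected only through the vertex of the
  chord.\<close>

lemma incident_side:
  assumes "a < n" "i < n" "endv T (x a) c = u i" 
    and "j < n" "mate j \<noteq> j" "u j \<noteq> u i"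
  shows "a \<in> side j \<longleftrightarrow> i \<in> side j"
proof -
  have "a \<in> side j \<longleftrightarrow> i \<in> side j" if "face a = face i"
    using face_side[of j i a] that assms by (auto simp: in_face_iff)
  moreover have "a \<in> side j \<longleftrightarrow> mate i \<in> side j" if "face a = face (mate i)"
    using face_side[of j "mate i" a] that assms by (auto simp: in_face_iff)
  moreover have "mate i \<in> side j \<longleftrightarrow> i \<in> side j"
    using mate_in_side[of j i] assms by (metis u_mate)
  ultimately show ?thesis using incident_face[OF assms(1-3)] by auto
qed

text \<open>
  A closed walk can change the face only at a vertex visited twice by the given walk; it then passes
  to the other side of a chord, and has to return through the same vertex.
\<close>

lemma cycle_in_face:
  assumes "walk T v q v" "distinct (map (arc_end T) q)" 
    and a: "\<And>k. k < length q \<Longrightarrow> a k < n \<and> fst (q ! k) = x (a k)" 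
    and k: "k < length q"
  shows "face (a k) = face (a 0)"
proof -
  let ?L = "length q"
  have step: "face (a k) = face (a (Suc k mod ?L))" if k: "k < ?L" for k
  proof (rule ccontr)
    assume neq: "face (a k) \<noteq> face (a (Suc k mod ?L))"
    have ends: "arc_end T (q ! j) = endv T (x (a j)) (\<not> snd (q ! j))"
      "arc_end T (q ! j) = endv T (x (a (Suc j mod ?L))) (snd (q ! (Suc j mod ?L)))" 
      "a j < n" "a (Suc j mod ?L) < n" "\<exists>i<n. arc_end T (q ! j) = u i" 
      if "j < ?L" for j
    proof -
      have m: "Suc j mod ?L < ?L" by (rule mod_less_divisor) (use that in linarith)
      show 1: "arc_end T (q ! j) = endv T (x (a j)) (\<not> snd (q ! j))" using a that by simp
      show "arc_end T (q ! j) = endv T (x (a (Suc j mod ?L))) (snd (q ! (Suc j mod ?L)))"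
        using closed_walk_nth(2)[OF assms(1) that] a[OF m] by simp
      show "a j < n" "a (Suc j mod ?L) < n" using a m that by auto
      then have "endv T (x (a j)) (\<not> snd (q ! j)) \<in> verts T" 
        using wf x_in_edges by (simp add: wf_signed_graph_def)
      then show "\<exists>i<n. arc_end T (q ! j) = u i" using 1 by (auto simp: verts_T)
    qed
    obtain i where i: "i < n" "arc_end T (q ! k) = u i" using ends(5)[OF k] by auto
    have f: "face (a k) = face i \<or> face (a k) = face (mate i)"
      "face (a (Suc k mod ?L)) = face i \<or> face (a (Suc k mod ?L)) = face (mate i)"
      using incident_face[of "a k" i] incident_face[of "a (Suc k mod ?L)" i] ends[OF k] i by metis+
    then have m: "mate i \<noteq> i" using neq by auto
    have sides: "j \<in> side i" if "face j = face i" for j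
      using face_side[OF i(1) m i(1), of j] i m that by (simp add: in_face_iff)
    have sides': "j \<notin> side i" if "face j = face (mate i)" for j
      using face_side[OF i(1) m, of "mate i" j] i m that by (simp add: in_face_iff)
    have "(a k \<in> side i) \<noteq> (a (Suc k mod ?L) \<in> side i)"
      using f neq sides sides' by metis
    moreover have "(a k \<in> side i) = (a (Suc k mod ?L) \<in> side i)"
    proof (rule cyclic_change[OF k])
      fix j assume j: "j < ?L" "j \<noteq> k"
      obtain i' where i': "i' < n" "arc_end T (q ! j) = u i'" using ends(5)[OF j(1)] by auto
      have "arc_end T (q ! j) \<noteq> arc_end T (q ! k)"
        using nth_eq_iff_index_eq[OF assms(2), of j k] j k by simp
      then have "u i \<noteq> u i'" using i i' by simp
      then show "(a j \<in> side i) = (a (Suc j mod ?L) \<in> side i)"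
        using incident_side[of "a j" i' _ i] incident_side[of "a (Suc j mod ?L)" i' _ i] ends[OF j(1)] i i' m by metis
    qed
    ultimately show False by simp
  qed
  show ?thesis using k
  proof (induction k)
    case (Suc k)
    then show ?case using step[of k] by simp
  qed simp
qed

text \<open>A proper subset of the edges of a face touches more vertices than it has edges.\<close>

lemma cycle_is_face:
  assumes "is_cycle T C"
  obtains i where "i < n" "i \<notin> doubled" "C = x ` face i"
proof -
  obtain v q where q: "simple_closed_path T v q" "C = set (walk_edges q)"
    using assms by (auto simp: is_cycle_def)
  let ?L = "length q"
  have W: "walk T v q v" "q \<noteq> []" "distinct (map (arc_end T) q)" "distinct (walk_edges q)"
    using q by (auto simp: simple_closed_path_def walk_verts_eq)
  have "\<exists>i. i < n \<and> fst (q ! k) = x i" if "k < ?L" for k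
    using closed_walk_nth(1)[OF W(1) that] by (auto simp: edges_T)
  then obtain a where a: "\<And>k. k < ?L \<Longrightarrow> a k < n \<and> fst (q ! k) = x (a k)" by metis
  define i where "i = a 0"
  have i: "i < n" using a W by (simp add: i_def)
  have in_face: "a k \<in> face i" if "k < ?L" for k
    using cycle_in_face[OF W(1,3) a that] by (auto simp: in_face_iff i_def)
  define S where "S = {j \<in> face i. x j \<in> C}"
  have C: "C = (\<lambda>k. x (a k)) ` {..<?L}"
  proof -
    have "set q = (!) q ` {..<?L}" by (auto simp: set_conv_nth)
    then have "C = (\<lambda>k. fst (q ! k)) ` {..<?L}"
      using q by (simp add: walk_edges_def image_image)
    then show ?thesis using a by simp
  qed
  then have CS: "C = x ` S" using in_face by (auto simp: S_def)
  have S: "S \<subseteq> face i" "S \<subseteq> {..<n}" "finite S" using face_less[OF i] finite_face[of i] by (auto simp: S_def)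
  have "i \<in> S" using C W by (auto simp: S_def i_def)
  have "vertices_of T C = arc_end T ` set q"
  proof
    show "arc_end T ` set q \<subseteq> vertices_of T C" using q by (auto simp: vertices_of_def walk_edges_def)
    show "vertices_of T C \<subseteq> arc_end T ` set q"
    proof
      fix w assume "w \<in> vertices_of T C"
      then obtain k c where k: "k < ?L" "w = endv T (fst (q ! k)) c"
        using q by (auto simp: vertices_of_def walk_edges_def in_set_conv_nth)
      show "w \<in> arc_end T ` set q"
      proof (cases "c = snd (q ! k)")
        case True
        obtain j where "j < ?L" "Suc j mod ?L = k"
        proof (cases k)
          case 0
          then show ?thesis using that[of "?L - 1"] k by simp
        next
          case (Suc k')
          then show ?thesis using that[of k'] k by simp
        qed
        then have "w = arc_end T (q ! j)" using closed_walk_nth(2)[OF W(1), of j] True k(2) by simp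
        then show ?thesis using \<open>j < ?L\<close> by (intro image_eqI[of _ _ "q ! j"]) simp_all
      next
        case False
        then have "c = (\<not> snd (q ! k))" by simp
        then show ?thesis using k by (intro image_eqI[of _ _ "q ! k"]) simp_all
      qed
    qed
  qed
  then have "card (vertices_of T C) = ?L"
    using W(3) by (simp add: distinct_card flip: set_map)
  moreover have "card C = ?L" using distinct_card[OF W(4)] q(2) by (simp add: walk_edges_def)
  moreover have "card (vertices_of T C) = card (S \<union> turn ` S)"
    unfolding CS vertices_of_image[OF S(2)]
    using inj_on_face[OF i] S(1) turn_in_face_iff by (intro card_image) (auto intro: inj_on_subset)
  ultimately have eq: "card (S \<union> turn ` S) = card C" by simp
  also have "\<dots> \<le> card S" unfolding CS by (rule card_image_le[OF S(3)])
  finally have "turn ` S \<subseteq> S" using S(3) by (metis Un_upper1 Un_upper2 card_seteq finite_UnI finite_imageI)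
  have "face i \<subseteq> S"
  proof
    fix j assume "j \<in> face i"
    then show "j \<in> S" by (induction rule: orbit.induct) (use \<open>i \<in> S\<close> \<open>turn ` S \<subseteq> S\<close> in auto)
  qed
  then have SF: "S = face i" using S by blast
  \<comment> \<open>The face of a doubled edge has two positions, hence two vertices, but a single
    edge.\<close>
  have "i \<notin> doubled"
  proof
    assume D: "i \<in> doubled"
    then have "S = {i, turn i}" "C = {x i}" 
      using face_doubled SF CS doubled_turn(2)[OF D] by auto
    then have "S \<union> turn ` S = {i, turn i}" using doubled_turn(4)[OF D] by auto
    then show False using eq \<open>C = {x i}\<close> doubled_turn(3)[OF D] by simp
  qed
  then show ?thesis using that i CS SF by simp
qed

lemma distinct_faces_disjoint:
  assumes "i < n" "j < n" "i \<notin> doubled" "x ` face i \<noteq> x ` face j"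
  shows "x ` face i \<inter> x ` face j = {}"
proof (rule ccontr)
  assume "x ` face i \<inter> x ` face j \<noteq> {}"
  then obtain a c where ac: "a \<in> face i" "c \<in> face j" "x a = x c" by auto
  then have "a < n" "c < n" "a \<notin> doubled" using assms face_less face_doubled_iff by auto
  then have "a = c" using x_eqD ac by metis
  then have "face i = face j" using ac face_eqI by metis
  then show False using assms by simp
qed

lemma face_edges_eq_iff:
  assumes "i < n" "j < n" "i \<notin> doubled"
  shows "x ` face i = x ` face j \<longleftrightarrow> face i = face j"
proof
  assume "x ` face i = x ` face j"
  then have "x i \<in> x ` face j" by (metis image_eqI self_in_face)
  then obtain c where c: "c \<in> face j" "x i = x c" by auto
  then have "c = i" using x_eqD assms face_less by metis
  then show "face i = face j" using c face_eqI by metis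
qed simp

end

section \<open>Cut-points\<close>

lemma walk_end_in_verts: "walk G v p w \<Longrightarrow> w \<in> verts G"
  by (induction p arbitrary: v) (auto simp: walk_Cons)

lemma components_mutually_reachable:
  assumes "\<And>v w. v \<in> verts G \<Longrightarrow> w \<in> verts G \<Longrightarrow> \<exists>p. walk G v p w"
  shows "components G = (if verts G = {} then {} else {verts G})"
proof -
  have "{(v, w). \<exists>p. walk G v p w} `` {v} = verts G" if "v \<in> verts G" for v
    using assms that walk_end_in_verts by fast
  then show ?thesis by (auto simp: components_def quotient_def)
qed

lemma wf_delete_vertex: "wf_signed_graph G \<Longrightarrow> wf_signed_graph (delete_vertex G v)"
  by (auto simp: wf_signed_graph_def delete_vertex_def)

lemma finite_components: "finite (verts G) \<Longrightarrow> finite (components G)"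
  by (simp add: components_def quotient_def)

context noncrossing_walk
begin

lemma card_components_T: "card (components T) = 1"
  using connected_T components_mutually_reachable[of T] by (auto simp: connected_graph_def)

text \<open>The remainder of the closed walk still joins all other vertices. A loop at a vertex
  visited once must be the whole walk, and then no vertex remains.\<close>

lemma unmatched_not_cut_point:
  assumes i: "i < n" "mate i = i"
  shows "\<not> cut_point T (u i)"
proof -
  let ?H = "delete_vertex T (u i)"
  have ui: "u j = u i \<longleftrightarrow> j = i" if "j < n" for j using u_eq_iff[of i j] i that by auto
  have verts_H: "verts ?H = u ` ({..<n} - {i})" 
    using i by (auto simp: delete_vertex_def verts_T ui)
  have "card (components ?H) + card (loops_at T (u i)) \<le> 1"
  proof (cases "n = 1")
    case True
    then have "verts ?H = {}" using i unfolding verts_H by auto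
    then have "components ?H = {}" by (simp add: components_def)
    moreover have "loops_at T (u i) \<subseteq> {x 0}" using True by (auto simp: loops_at_def edges_T)
    then have "card (loops_at T (u i)) \<le> card {x 0}" by (intro card_mono) auto
    ultimately show ?thesis by simp
  next
    case False
    have "loops_at T (u i) = {}"
    proof -
      have False if "k < n" "\<forall>c. endv T (x k) c = u i" for k
      proof -
        have "u k = u i" "u (nxt k) = u i" using that start_T[of k] end_T[of k] by auto
        then show False using ui[of k] ui[of "nxt k"] nxt_fixed[of i] that False i by simp
      qed
      then show ?thesis by (auto simp: loops_at_def edges_T)
    qed
    moreover have reach: "\<exists>p. walk ?H (u (nxt i)) p w" if "w \<in> verts ?H" for w
    proof -
      obtain j where j: "j < n" "j \<noteq> i" "w = u j" using \<open>w \<in> verts ?H\<close> unfolding verts_H by blast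
      obtain t where t: "t < n" "(nxt ^^ t) (nxt i) = j" using nxt_reach[of "nxt i" j] i j by auto
      let ?f = "\<lambda>t. (nxt ^^ t) (nxt i)"
      \<comment> \<open>From \<open>nxt i\<close> it takes \<open>n - 1\<close> steps to come back
        to \<open>i\<close>. As \<open>s \<le> t < n\<close>, this would force \<open>s = t\<close>,
        but step \<open>t\<close> ends at \<open>j\<close>.\<close>
      have ne: "?f s \<noteq> i" if "s \<le> t" for s
      proof
        assume *: "?f s = i"
        then have "(nxt ^^ Suc s) i = i" by (simp add: funpow_swap1)
        then have "(i + Suc s) mod n = i" using i by (simp add: funpow_nxt del: funpow.simps)
        then have "Suc s = n" using i t that by (auto simp: mod_if split: if_splits)
        then have "s = t" using t(1) that by linarith
        then show False using * t(2) j(2) by simp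
      qed
      have le: "?f s < n" for s using i by simp
      have V: "u (?f s) \<in> verts ?H" if "s \<le> t" for s
        using ne[OF that] le by (auto simp: verts_H)
      have "x (?f s) \<in> edges ?H" if "s < t" for s
      proof -
        have "endv T (x (?f s)) c \<noteq> u i" for c
          using le[of s]
        proof (cases rule: edge_end_cases[of "?f s" c])
          case 1
          then show ?thesis using ui le ne[of s] that by auto
        next
          case 2
          have "u (nxt (?f s)) \<noteq> u i" using ui[OF le[of "Suc s"]] ne[of "Suc s"] that by simp
          then show ?thesis using 2 by simp
        qed
        then show ?thesis using le by (simp add: delete_vertex_def x_in_edges)
      qed
      then have "walk ?H (u (?f 0)) (arcs ?f t) (u (?f t))"
        using V le by (intro walk_arcs) (auto simp: delete_vertex_def)
      then show ?thesis using t j by auto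
    qed
    then have "\<exists>p. walk ?H v p w" if "v \<in> verts ?H" "w \<in> verts ?H" for v w
      using walk_reverse[OF wf_delete_vertex[OF wf]] walk_append that by meson
    then have "card (components ?H) \<le> 1" by (subst components_mutually_reachable) auto
    ultimately show ?thesis by simp
  qed
  then show ?thesis by (simp add: cut_point_def card_components_T)
qed

text \<open>The remaining edges avoid \<open>u i\<close>, so \<open>incident_side\<close> keeps each
  of them and its ends on one side. Removing \<open>i\<close> from the side removes
  \<open>u i\<close>, as \<open>mate i\<close> is not in it.\<close>

lemma delete_vertex_side:
  assumes i: "i < n" "mate i \<noteq> i"
    and "walk (delete_vertex T (u i)) v p w" "v \<in> u ` (side i - {i})"
  shows "w \<in> u ` (side i - {i})"
  using assms(3,4)
proof (induction p arbitrary: v)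
  case Nil
  then show ?case by simp
next
  case (Cons a p)
  obtain k where k: "v = u k" "k \<in> side i" "k \<noteq> i" using Cons.prems by auto
  have "fst a \<in> edges T" "\<And>c. endv T (fst a) c \<noteq> u i" "arc_start T a = v"
    using Cons.prems(1) unfolding walk_Cons by (simp_all add: delete_vertex_def)
  then obtain j where j: "j < n" "fst a = x j" "u i \<noteq> endv T (x j) (\<not> snd a)" 
    "u i \<noteq> endv T (x j) (snd a)" "endv T (x j) (snd a) = v"
    unfolding edges_T by (metis imageE lessThan_iff)
  have "k < n" using k side_subset i by auto
  then have "j \<in> side i" using incident_side[of j k "snd a" i] i j k by metis
  have "endv T (x j) (\<not> snd a) \<in> verts T" using wf j x_in_edges by (simp add: wf_signed_graph_def)
  then obtain l where l: "l < n" "endv T (x j) (\<not> snd a) = u l" by (auto simp: verts_T)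
  then have "l \<in> side i" using incident_side[of j l "\<not> snd a" i] i j \<open>j \<in> side i\<close> by metis
  then have "endv T (x j) (\<not> snd a) \<in> u ` (side i - {i})" using l j by auto
  moreover have "walk (delete_vertex T (u i)) (endv T (x j) (\<not> snd a)) p w"
    using Cons.prems j by (simp add: walk_Cons delete_vertex_def)
  ultimately show ?case using Cons.IH by blast
qed

text \<open>A side with a single edge leads straight from \<open>i\<close> to \<open>mate i\<close>.
  It leaves no component behind, but its loop counts in \<open>cut_point\<close>.\<close>

lemma trivial_side_loop:
  assumes "i < n" "mate i \<noteq> i" "side i \<subseteq> {i}"
  shows "nxt i = mate i" "x i \<in> loops_at T (u i)"
proof -
  have "nxt i \<noteq> i" using nxt_fixed[OF assms(1)] assms(1,2) mate_less[OF assms(1)] by (metis less_one)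
  then show *: "nxt i = mate i" using assms by (intro nxt_leaves_side) auto
  have "endv T (x i) c = u i" for c
    using assms(1) by (cases rule: edge_end_cases[of i c]) (auto simp: *)
  then show "x i \<in> loops_at T (u i)" using assms by (simp add: loops_at_def x_in_edges)
qed

text \<open>Each side of the chord contributes at least one to the count: a component if it has a
  further position, a loop otherwise.\<close>

lemma matched_cut_point:
  assumes i: "i < n" "mate i \<noteq> i"
  shows "cut_point T (u i)"
proof -
  let ?H = "delete_vertex T (u i)"
  let ?r = "{(v, w). \<exists>p. walk ?H v p w}"
  have fin: "finite (verts T)" "finite (edges T)" using wf by (auto simp: wf_signed_graph_def)
  have finC: "finite (components ?H)" using fin by (intro finite_components) (simp add: delete_vertex_def)
  have finL: "finite (loops_at T (u i))" using fin by (simp add: loops_at_def)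
  let ?m = "mate i"
  have m: "?m < n" "mate ?m \<noteq> ?m" using i by (auto dest: sym)
  have in_H: "u k \<in> verts ?H" if "k < n" "k \<noteq> i" "k \<noteq> ?m" for k
    using that i u_eq_iff[of i k] by (auto simp: delete_vertex_def verts_T)
  have cls: "?r `` {u k} \<in> components ?H" if "k < n" "k \<noteq> i" "k \<noteq> ?m" for k
    unfolding components_def by (rule quotientI[OF in_H[OF that]])
  \<comment> \<open>An edge is never traversed twice in succession, so two trivial sides give two
    different loops.\<close>
  have loops: "x i \<noteq> x ?m" if "nxt i = ?m" 
    using same_edge[of i ?m] that i by auto
  have C1: "1 \<le> card (components ?H)" if "k < n" "k \<noteq> i" "k \<noteq> ?m" for k
    using cls[OF that] finC by (auto simp: Suc_le_eq card_gt_0_iff)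
  have L1: "1 \<le> card (loops_at T (u i))" if "e \<in> loops_at T (u i)" for e
    using that finL by (auto simp: Suc_le_eq card_gt_0_iff)
  have side_m: "side ?m = {..<n} - side i" using side_mate i by simp
  have "2 \<le> card (components ?H) + card (loops_at T (u i))"
  proof (cases "side i \<subseteq> {i}")
    case A: True
    note loop = trivial_side_loop[OF i A]
    show ?thesis
    proof (cases "side ?m \<subseteq> {?m}")
      case True
      have "x ?m \<in> loops_at T (u i)" using trivial_side_loop(2)[OF m True] unfolding u_mate .
      then have "{x i, x ?m} \<subseteq> loops_at T (u i)" using loop(2) by blast
      then have "card {x i, x ?m} \<le> card (loops_at T (u i))" by (intro card_mono finL)
      then show ?thesis using loops[OF loop(1)] by simp
    next
      case False
      then obtain k where "k \<in> {..<n} - side i" "k \<noteq> ?m" unfolding side_m by blast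
      then have "k < n" "k \<noteq> i" "k \<noteq> ?m" using self_in_side[OF i] by auto
      then show ?thesis using C1[of k] L1[OF loop(2)] by linarith
    qed
  next
    case False
    then obtain k where k: "k \<in> side i" "k \<noteq> i" by auto
    then have k': "k < n" "k \<noteq> ?m" using side_subset[OF i(1)] mate_notin_side[OF i] by auto
    show ?thesis
    proof (cases "side ?m \<subseteq> {?m}")
      case True
      have "x ?m \<in> loops_at T (u i)" using trivial_side_loop(2)[OF m True] unfolding u_mate .
      then show ?thesis using C1[of k] L1[of "x ?m"] k k' by linarith
    next
      case False
      then obtain l where "l \<in> {..<n} - side i" "l \<noteq> ?m" unfolding side_m by blast
      then have l: "l < n" "l \<noteq> ?m" "l \<notin> side i" by auto
      then have l': "l \<noteq> i" using self_in_side[OF i] by blast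
      have "u l \<notin> u ` (side i - {i})"
      proof
        assume "u l \<in> u ` (side i - {i})"
        then obtain j where j: "j \<in> side i" "j \<noteq> i" "u j = u l" by (metis DiffE image_iff insertI1)
        then have jn: "j < n" "j \<noteq> ?m" using side_subset[OF i(1)] mate_notin_side[OF i] by auto
        have "l = mate j" using u_eq_iff[OF jn(1) l(1)] l(3) j by metis
        then show False using mate_in_side[OF i jn(1) j(2) jn(2)] j(1) l(3) by simp
      qed
      moreover have "u k \<in> u ` (side i - {i})" using k by simp
      ultimately have "u l \<notin> ?r `` {u k}" using delete_vertex_side[OF i] by blast
      moreover have "u l \<in> ?r `` {u l}" using in_H[OF l(1) l' l(2)] by (auto intro: exI[of _ "[]"])
      ultimately have "?r `` {u k} \<noteq> ?r `` {u l}" by auto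
      then have "card {?r `` {u k}, ?r `` {u l}} = 2" by simp
      moreover have "{?r `` {u k}, ?r `` {u l}} \<subseteq> components ?H" 
        using cls[of k] cls[of l] k k' l l' by simp
      ultimately have "2 \<le> card (components ?H)" using card_mono[OF finC] by metis
      then show ?thesis by simp
    qed
  qed
  then show ?thesis using i by (simp add: cut_point_def card_components_T u_in_verts)
qed

lemma cut_point_iff: "i < n \<Longrightarrow> cut_point T (u i) \<longleftrightarrow> mate i \<noteq> i"
  using matched_cut_point unmatched_not_cut_point by blast

section \<open>The cycle-tree structure\<close>

definition block_cycles :: "'e set set" where
  "block_cycles = {C. is_cycle T C}"

text \<open>For a start of a run, the path has at least one edge. Where two block cycles touch,
  their common vertex already is an intersection vertex, and no path of length zero is
  introduced.\<close>

definition block_path :: "nat \<Rightarrow> 'v \<times> ('e \<times> bool) list" where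
  "block_path i = (u i, arcs (\<lambda>t. (nxt ^^ t) i) (run i))"

text \<open>The walk runs through every block path in both directions; one of the two runs is selected.\<close>

definition path_starts :: "nat set" where
  "path_starts = {i \<in> starts. i < return i}"

definition block_paths :: "('v \<times> ('e \<times> bool) list) set" where
  "block_paths = block_path ` path_starts"

lemma block_cyclesE:
  assumes "C \<in> block_cycles"
  obtains i where "i < n" "i \<notin> doubled" "C = x ` face i"
  using assms cycle_is_face by (auto simp: block_cycles_def)

lemma face_in_block_cycles: "i < n \<Longrightarrow> i \<notin> doubled \<Longrightarrow> x ` face i \<in> block_cycles"
  by (simp add: block_cycles_def face_is_cycle)

lemma path_startsD: "i \<in> path_starts \<Longrightarrow> i \<in> starts"
  by (simp add: path_starts_def)

lemma walk_verts_block_path: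
  "i < n \<Longrightarrow> walk_verts T (u i) (arcs (\<lambda>t. (nxt ^^ t) i) k) = map (\<lambda>t. u ((nxt ^^ t) i)) [0..<Suc k]"
  using walk_verts_arcs[of T k "\<lambda>t. (nxt ^^ t) i"] by simp

lemma path_verts_block_path:
  "i < n \<Longrightarrow> path_verts T (block_path i) = (\<lambda>t. u ((nxt ^^ t) i)) ` {..run i}"
  by (simp add: path_verts_def block_path_def walk_verts_block_path atLeast0LessThan lessThan_Suc_atMost del: upt_Suc)

lemma path_ends_block_path:
  "i < n \<Longrightarrow> path_ends T (block_path i) = {u i, u ((nxt ^^ run i) i)}"
  by (simp add: path_ends_def block_path_def walk_verts_block_path)

lemma path_edges_block_path:
  "path_edges (block_path i) = (\<lambda>t. x ((nxt ^^ t) i)) ` {..<run i}"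
  by (simp add: path_edges_def block_path_def walk_edges_def arcs_def arc_def image_image atLeast0LessThan)

lemma block_cycle_edges_eq: "block_cycle_edges block_cycles = x ` ({..<n} - doubled)"
proof
  show "block_cycle_edges block_cycles \<subseteq> x ` ({..<n} - doubled)"
    using face_less face_doubled_iff by (fastforce simp: block_cycle_edges_def elim!: block_cyclesE)
  show "x ` ({..<n} - doubled) \<subseteq> block_cycle_edges block_cycles"
  proof clarify
    fix i assume i: "i < n" "i \<notin> doubled"
    have "x i \<in> x ` face i" by simp
    then show "x i \<in> block_cycle_edges block_cycles"
      using face_in_block_cycles[OF i] unfolding block_cycle_edges_def by blast
  qed
qed

lemma doubled_in_selected_run:
  assumes "k \<in> doubled"
  obtains i a where "i \<in> path_starts" "a < run i" "k = (nxt ^^ a) i \<or> k = turn ((nxt ^^ a) i)"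
proof -
  obtain i a where ia: "i \<in> starts" "a < run i" "k = (nxt ^^ a) i" 
    using doubled_in_run assms by blast
  show ?thesis
  proof (cases "i < return i")
    case True
    then show ?thesis using that ia by (auto simp: path_starts_def)
  next
    case False
    \<comment> \<open>Here the return is the selected run; it contains the reversed copy of
      \<open>k\<close> at the complementary index.\<close>
    have "(nxt ^^ (run i - 1 - a)) (return i) = turn k"
      using return_funpow[of i "run i - 1 - a"] ia starts_doubled by simp
    then have "k = turn ((nxt ^^ (run i - 1 - a)) (return i))" 
      using doubled_turn(4)[OF assms] by simp
    moreover have "return i \<in> path_starts" 
      using return_starts return_return return_neq[OF ia(1)] ia False by (simp add: path_starts_def)
    ultimately show ?thesis using that[of "return i" "run i - 1 - a"] run_return ia by simp
  qed
qed

lemma block_path_edges_eq: "block_path_edges block_paths = x ` doubled"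
proof
  show "block_path_edges block_paths \<subseteq> x ` doubled"
    using run_doubled by (auto simp: block_path_edges_def block_paths_def path_edges_block_path)
  show "x ` doubled \<subseteq> block_path_edges block_paths"
  proof
    fix e assume "e \<in> x ` doubled"
    then obtain k where k: "k \<in> doubled" "e = x k" by auto
    obtain i a where ia: "i \<in> path_starts" "a < run i" "k = (nxt ^^ a) i \<or> k = turn ((nxt ^^ a) i)"
      using doubled_in_selected_run k by blast
    then have "e = x ((nxt ^^ a) i)" using k doubled_turn(2) run_doubled by metis
    then show "e \<in> block_path_edges block_paths"
      using ia by (auto simp: block_path_edges_def block_paths_def path_edges_block_path)
  qed
qed

lemma block_edges_disjoint: "block_cycle_edges block_cycles \<inter> block_path_edges block_paths = {}"
  unfolding block_cycle_edges_eq block_path_edges_eq using doubled_less x_eqD by blast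

text \<open>A visit of a run is doubled except at the end of the run, and its mate, on the return,
  is doubled except at the end of the return, that is, for \<open>t = 0\<close>. So inner vertices
  of block paths avoid the block cycles.\<close>

lemma run_meets_cycles:
  assumes "i \<in> starts" "t \<le> run i" "k < n" "k \<notin> doubled" "u ((nxt ^^ t) i) = u k"
  shows "t = 0 \<and> k = mate i \<or> t = run i \<and> k = (nxt ^^ run i) i"
proof -
  have i: "i \<in> doubled" "i < n" using assms starts_doubled starts_less by auto
  consider "k = (nxt ^^ t) i" | "k = mate ((nxt ^^ t) i)" 
    using u_eq_iff[of "(nxt ^^ t) i" k] assms i by auto
  then show ?thesis
  proof cases
    case 1
    then show ?thesis using run_doubled[of t i] assms by (metis le_neq_implies_less)
  next
    case 2
    then have "k = (nxt ^^ (run i - t)) (return i)" using mate_run[OF i(1)] assms by simp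
    then have "\<not> run i - t < run (return i)" using run_doubled assms by metis
    then have "t = 0" using run_return assms run_pos[OF i(1)] by simp
    then show ?thesis using 2 by simp
  qed
qed

lemma block_path_meets:
  assumes "i \<in> path_starts"
  defines "C \<equiv> x ` face (mate i)" and "D \<equiv> x ` face ((nxt ^^ run i) i)"
  shows "C \<noteq> D"
    "{B \<in> block_cycles. path_verts T (block_path i) \<inter> vertices_of T B \<noteq> {}} = {C, D}"
    "path_verts T (block_path i) \<inter> vertices_of T C = {u i}"
    "path_verts T (block_path i) \<inter> vertices_of T D = {u ((nxt ^^ run i) i)}"
proof -
  let ?e = "(nxt ^^ run i) i"
  have s: "i \<in> starts" using assms path_startsD by simp
  then have i: "i \<in> doubled" "i < n" using starts_doubled starts_less by auto
  have me: "mate i < n" "mate i \<notin> doubled" "?e < n" "?e \<notin> doubled"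
    using i mate_start_not_doubled[OF s] run_end by auto
  have F: "face ?e \<noteq> face (mate i)" by (rule run_end_face[OF s])
  then show "C \<noteq> D" using me by (simp add: C_def D_def face_edges_eq_iff)
  have meet: "w = u i \<and> mate i \<in> face j \<or> w = u ?e \<and> ?e \<in> face j"
    if w: "w \<in> path_verts T (block_path i) \<inter> vertices_of T (x ` face j)" "j < n" "j \<notin> doubled" for w j
  proof -
    have "w \<in> (\<lambda>t. u ((nxt ^^ t) i)) ` {..run i}"
      using IntD1[OF w(1)] unfolding path_verts_block_path[OF i(2)] .
    then obtain t where t: "t \<le> run i" "w = u ((nxt ^^ t) i)" by blast
    obtain k where k: "k \<in> face j" "w = u k" using w by (auto simp: vertices_of_face)
    then have "k < n" "k \<notin> doubled" using w face_less face_doubled_iff by auto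
    then have "t = 0 \<and> k = mate i \<or> t = run i \<and> k = ?e"
      using run_meets_cycles[OF s t(1)] t k by metis
    then show ?thesis using t k by auto
  qed
  have ui: "u i \<in> path_verts T (block_path i)" "u ?e \<in> path_verts T (block_path i)"
    unfolding path_verts_block_path[OF i(2)] by (auto intro: image_eqI[of _ _ 0])
  have uC: "u i \<in> vertices_of T C" 
    using me by (simp add: C_def vertices_of_face) (metis image_eqI self_in_face u_mate)
  have uD: "u ?e \<in> vertices_of T D" using me by (simp add: D_def vertices_of_face)
  show "path_verts T (block_path i) \<inter> vertices_of T C = {u i}"
    using meet[OF _ me(1,2)] ui(1) uC F[folded in_face_iff] unfolding C_def by blast
  show "path_verts T (block_path i) \<inter> vertices_of T D = {u ?e}"
    using meet[OF _ me(3,4)] ui(2) uD F[symmetric, folded in_face_iff] unfolding D_def by blast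
  show "{B \<in> block_cycles. path_verts T (block_path i) \<inter> vertices_of T B \<noteq> {}} = {C, D}"
  proof
    show "{C, D} \<subseteq> {B \<in> block_cycles. path_verts T (block_path i) \<inter> vertices_of T B \<noteq> {}}"
      using face_in_block_cycles[OF me(1,2)] face_in_block_cycles[OF me(3,4)] ui uC uD
      unfolding C_def D_def by blast
    show "{B \<in> block_cycles. path_verts T (block_path i) \<inter> vertices_of T B \<noteq> {}} \<subseteq> {C, D}"
    proof
      fix B assume B: "B \<in> {B \<in> block_cycles. path_verts T (block_path i) \<inter> vertices_of T B \<noteq> {}}"
      then obtain j where j: "j < n" "j \<notin> doubled" "B = x ` face j" using block_cyclesE by blast
      then have "mate i \<in> face j \<or> ?e \<in> face j" using B meet by auto
      then show "B \<in> {C, D}" using j face_eqI unfolding C_def D_def by blast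
    qed
  qed
qed

lemma intersection_vertices_matched:
  assumes "v \<in> intersection_vertices T block_cycles block_paths"
  obtains i where "i < n" "mate i \<noteq> i" "v = u i"
proof -
  from assms consider C D where "C \<in> block_cycles" "D \<in> block_cycles" "C \<noteq> D" 
      "v \<in> vertices_of T C" "v \<in> vertices_of T D" 
    | P where "P \<in> block_paths" "v \<in> path_ends T P"
    by (auto simp: intersection_vertices_def)
  then show ?thesis
  proof cases
    case 1
    then obtain i j where ij: "i < n" "j < n" "C = x ` face i" "D = x ` face j" 
      by (metis block_cyclesE)
    then obtain a c where ac: "a \<in> face i" "c \<in> face j" "v = u a" "v = u c"
      using 1 vertices_of_face by (metis imageE)
    have "a < n" "c < n" using ac ij face_less by auto
    moreover have "a \<noteq> c" using 1 ij ac face_eqI by metis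
    ultimately show ?thesis using that[of a] ac u_eq_iff[of a c] by auto
  next
    case 2
    then obtain i where i: "i \<in> starts" "v = u i \<or> v = u ((nxt ^^ run i) i)"
      using path_ends_block_path path_startsD starts_less by (auto simp: block_paths_def)
    have D: "i \<in> doubled" "i < n" using i starts_doubled starts_less by auto
    have "mate ((nxt ^^ run i) i) = return i" using mate_run[OF D(1)] by simp
    then have "mate ((nxt ^^ run i) i) \<noteq> (nxt ^^ run i) i" 
      using return_doubled run_end D by metis
    then show ?thesis using that[of i] that[of "(nxt ^^ run i) i"] i D doubled_turn(7) by auto
  qed
qed

text \<open>If the other visit is doubled, a block path ends here, given by the run or by its
  return, whichever is selected; otherwise the other visit lies on a second block cycle.\<close>

lemma matched_on_cycle_intersection:
  assumes "i < n" "i \<notin> doubled" "mate i \<noteq> i"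
  shows "u i \<in> intersection_vertices T block_cycles block_paths"
proof (cases "mate i \<in> doubled")
  case True
  then obtain j where j: "j \<in> starts" "i = (nxt ^^ run j) j" 
    using run_end_at_mate_doubled assms by blast
  have "\<exists>P\<in>block_paths. u i \<in> path_ends T P"
  proof (cases "j < return j")
    case True
    then have "j \<in> path_starts" using j by (simp add: path_starts_def)
    then show ?thesis using j starts_less path_ends_block_path by (auto simp: block_paths_def)
  next
    case False
    then have *: "return j \<in> path_starts" 
      using return_starts return_return return_neq[OF j(1)] j by (simp add: path_starts_def)
    have "u i = u (mate i)" by simp
    also have "mate i = return j" using mate_run[of j "run j"] j starts_doubled by simp
    finally show ?thesis using * path_ends_block_path[of "return j"] starts_less path_startsD
      by (auto simp: block_paths_def)
  qed
  then show ?thesis by (auto simp: intersection_vertices_def)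
next
  case False
  have m: "mate i < n" using assms by simp
  have "x ` face i \<noteq> x ` face (mate i)" 
    using face_edges_eq_iff[OF assms(1) m assms(2)] face_mate_neq[OF assms(1,3)] by metis
  moreover have "u i \<in> vertices_of T (x ` face i) \<inter> vertices_of T (x ` face (mate i))"
    using assms m by (simp add: vertices_of_face) (metis image_eqI self_in_face u_mate)
  ultimately show ?thesis
    using face_in_block_cycles assms m False unfolding intersection_vertices_def by blast
qed

text \<open>Reduces the parity condition to the number of matched positions of a face, the exponent
  in \<open>face_sign\<close>.\<close>

lemma cycle_intersection_vertices:
  assumes "i < n" "i \<notin> doubled"
  shows "vertices_of T (x ` face i) \<inter> intersection_vertices T block_cycles block_paths =
    u ` {k \<in> face i. mate k \<noteq> k}"
proof
  show "u ` {k \<in> face i. mate k \<noteq> k} \<subseteq> 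
      vertices_of T (x ` face i) \<inter> intersection_vertices T block_cycles block_paths"
  proof clarify
    fix k assume k: "k \<in> face i" "mate k \<noteq> k"
    then have "k < n" "k \<notin> doubled" using face_less face_doubled_iff assms by auto
    then show "u k \<in> vertices_of T (x ` face i) \<inter> intersection_vertices T block_cycles block_paths"
      using k matched_on_cycle_intersection assms by (simp add: vertices_of_face)
  qed
  show "vertices_of T (x ` face i) \<inter> intersection_vertices T block_cycles block_paths \<subseteq>
      u ` {k \<in> face i. mate k \<noteq> k}"
  proof
    fix v assume v: "v \<in> vertices_of T (x ` face i) \<inter> intersection_vertices T block_cycles block_paths"
    then obtain k where k: "k \<in> face i" "v = u k" using assms by (auto simp: vertices_of_face)
    obtain j where j: "j < n" "mate j \<noteq> j" "v = u j" using v intersection_vertices_matched by blast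
    have "k = j \<or> k = mate j" using u_eq_iff[of j k] j k face_less assms by metis
    then have "mate k \<noteq> k" using j by auto
    then show "v \<in> u ` {k \<in> face i. mate k \<noteq> k}" using k by simp
  qed
qed

lemma cycle_tree_T:
  assumes "signed_subgraph T G"
  shows "cycle_tree G T block_cycles block_paths"
  unfolding cycle_tree_def
proof (intro conjI)
  show "signed_subgraph T G" "connected_graph T" "block_cycles = {C. is_cycle T C}"
    by (rule assms connected_T block_cycles_def)+
  show "edges T = block_cycle_edges block_cycles \<union> block_path_edges block_paths"
    unfolding block_cycle_edges_eq block_path_edges_eq edges_T using doubled_less by auto
  show "block_cycle_edges block_cycles \<inter> block_path_edges block_paths = {}"
    by (rule block_edges_disjoint)
  show "verts T = (\<Union>C\<in>block_cycles. vertices_of T C) \<union> (\<Union>P\<in>block_paths. path_verts T P)"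
  proof
    show "verts T \<subseteq> (\<Union>C\<in>block_cycles. vertices_of T C) \<union> (\<Union>P\<in>block_paths. path_verts T P)"
    proof
      fix v assume "v \<in> verts T"
      then obtain i where i: "i < n" "v = u i" by (auto simp: verts_T)
      show "v \<in> (\<Union>C\<in>block_cycles. vertices_of T C) \<union> (\<Union>P\<in>block_paths. path_verts T P)"
      proof (cases "i \<in> doubled")
        case False
        then have "v \<in> vertices_of T (x ` face i)" using i by (simp add: vertices_of_face)
        then show ?thesis using face_in_block_cycles False i by blast
      next
        case True
        then obtain j a where ja: "j \<in> path_starts" "a < run j" "i = (nxt ^^ a) j \<or> i = turn ((nxt ^^ a) j)"
          using doubled_in_selected_run by blast
        then have "v = u ((nxt ^^ a) j) \<or> v = u ((nxt ^^ Suc a) j)" using i by auto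
        then have "v \<in> path_verts T (block_path j)" 
          using ja path_startsD starts_less
          by (subst path_verts_block_path) (auto simp del: funpow.simps intro: less_imp_le Suc_leI)
        then show ?thesis using ja by (auto simp: block_paths_def)
      qed
    qed
    show "(\<Union>C\<in>block_cycles. vertices_of T C) \<union> (\<Union>P\<in>block_paths. path_verts T P) \<subseteq> verts T"
      using face_less starts_less path_startsD
      by (fastforce simp: verts_T vertices_of_face block_paths_def path_verts_block_path elim!: block_cyclesE)
  qed
  show "\<forall>C\<in>block_cycles. \<forall>D\<in>block_cycles. C \<noteq> D \<longrightarrow> C \<inter> D = {}"
    using distinct_faces_disjoint by (metis block_cyclesE)
  show "\<forall>C\<in>block_cycles. \<forall>D\<in>block_cycles. C \<noteq> D \<longrightarrow> card (vertices_of T C \<inter> vertices_of T D) \<le> 1"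
  proof (intro ballI impI)
    fix C D assume CD: "C \<in> block_cycles" "D \<in> block_cycles" "C \<noteq> D"
    then obtain i j where ij: "i < n" "j < n" "C = x ` face i" "D = x ` face j" by (metis block_cyclesE)
    then have "face i \<noteq> face j" using CD by auto
    then have "v = w" if "v \<in> vertices_of T C \<inter> vertices_of T D" "w \<in> vertices_of T C \<inter> vertices_of T D" for v w
      using distinct_faces_common_vertex[of i j v w] that ij by (auto simp: vertices_of_face)
    then show "card (vertices_of T C \<inter> vertices_of T D) \<le> 1"
      by (metis One_nat_def card_le_Suc0_iff_eq card.infinite zero_le)
  qed
  show "\<forall>P\<in>block_paths. \<forall>Q\<in>block_paths. P \<noteq> Q \<longrightarrow> path_verts T P \<inter> path_verts T Q = {}"
  proof (intro ballI impI)
    fix P Q assume "P \<in> block_paths" "Q \<in> block_paths" and PQ: "P \<noteq> Q"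
    then obtain i j where ij: "i \<in> path_starts" "P = block_path i" "j \<in> path_starts" "Q = block_path j"
      by (auto simp: block_paths_def)
    then have s: "i \<in> starts" "j \<in> starts" "j \<noteq> i" using PQ path_startsD by auto
    \<comment> \<open>Only one run of each pair is selected.\<close>
    have "j \<noteq> return i" using ij return_return[OF s(1)] by (auto simp: path_starts_def)
    note s = s this
    then have "u ((nxt ^^ a) i) \<noteq> u ((nxt ^^ c) j)" if "a \<le> run i" "c \<le> run j" for a c
      using run_vertex[OF s(1,2) that] by auto
    then show "path_verts T P \<inter> path_verts T Q = {}"
      using s starts_less by (auto simp: ij path_verts_block_path)
  qed
  show "\<forall>v\<in>intersection_vertices T block_cycles block_paths. cut_point T v"
    using intersection_vertices_matched cut_point_iff by metis
  show "\<forall>(v, p)\<in>block_paths. \<exists>w. simple_path T v p w \<and>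
      (\<exists>C D. C \<noteq> D \<and>
         {B \<in> block_cycles. path_verts T (v, p) \<inter> vertices_of T B \<noteq> {}} = {C, D} \<and>
         path_verts T (v, p) \<inter> vertices_of T C = {v} \<and>
         path_verts T (v, p) \<inter> vertices_of T D = {w})"
  proof clarify
    fix v p assume "(v, p) \<in> block_paths"
    then obtain i where i: "i \<in> path_starts" "(v, p) = block_path i" by (auto simp: block_paths_def)
    then have s: "i \<in> starts" "i < n" using path_startsD starts_less by auto
    have vp: "v = u i" "p = arcs (\<lambda>t. (nxt ^^ t) i) (run i)" using i by (auto simp: block_path_def)
    have "walk T v p (u ((nxt ^^ run i) i))"
      unfolding vp using walk_arcs[of T "run i" "\<lambda>t. (nxt ^^ t) i"] s by (auto simp: u_in_verts x_in_edges)
    moreover have "distinct (walk_verts T v p)"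
      unfolding vp walk_verts_block_path[OF s(2)] distinct_map
      using run_vertex_inj[OF s(1)] by (auto simp: inj_on_def less_Suc_eq_le simp del: upt_Suc)
    ultimately have "simple_path T v p (u ((nxt ^^ run i) i))" by (simp add: simple_path_def)
    then show "\<exists>w. simple_path T v p w \<and> (\<exists>C D. C \<noteq> D \<and>
         {B \<in> block_cycles. path_verts T (v, p) \<inter> vertices_of T B \<noteq> {}} = {C, D} \<and>
         path_verts T (v, p) \<inter> vertices_of T C = {v} \<and>
         path_verts T (v, p) \<inter> vertices_of T D = {w})"
      using block_path_meets[OF i(1), folded i(2) vp(1)] by (intro exI conjI)
  qed
qed

end

section \<open>Directions and parity\<close>

text \<open>\<open>sg i\<close> is the sign of departure at visit \<open>i\<close>.\<close>

locale directed_noncrossing_walk = noncrossing_walk n u x T b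
  for n :: nat and u :: "nat \<Rightarrow> 'v" and x :: "nat \<Rightarrow> 'e"
    and T :: "('v, 'e) signed_graph" and b :: "nat \<Rightarrow> bool" +
  fixes \<tau> :: "'e \<Rightarrow> bool \<Rightarrow> int" and sg :: "nat \<Rightarrow> int"
  assumes orientation: "orientation T \<tau>"
    and sg_start: "i < n \<Longrightarrow> \<tau> (x i) (b i) = sg i"
    and sg_end: "i < n \<Longrightarrow> \<tau> (x i) (\<not> b i) = - sg (nxt i)"
    and sg_mate: "i < n \<Longrightarrow> mate i \<noteq> i \<Longrightarrow> sg (mate i) = - sg i"
begin

lemma sg_values: "i < n \<Longrightarrow> sg i = 1 \<or> sg i = -1"
  using orientation x_in_edges sg_start[of i] by (auto simp: orientation_def) (metis insertE)+

lemma esign_x: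
  assumes "i < n" shows "esign T (x i) = sg i * sg (nxt i)"
proof -
  have "\<tau> (x i) (b i) * \<tau> (x i) (\<not> b i) = - esign T (x i)"
    using orientation x_in_edges[OF assms] by (cases "b i") (auto simp: orientation_def mult.commute)
  then show ?thesis using sg_start sg_end assms by simp
qed

text \<open>
  Along a face the signs \<open>sg\<close> are kept at an unmatched position and reversed at a matched one, so
  the sign of the cycle counts the reversals.
\<close>

lemma face_sign:
  assumes "i < n"
  shows "(\<Prod>k\<in>face i. esign T (x k)) = (-1) ^ card {k \<in> face i. mate k \<noteq> k}"
proof -
  define \<delta> :: "nat \<Rightarrow> int" where "\<delta> k = (if mate k \<noteq> k then -1 else 1)" for k
  have "esign T (x k) = sg k * (\<delta> (turn k) * sg (turn k))" if "k \<in> face i" for k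
  proof -
    have k: "k < n" "turn k < n" using that assms face_less by auto
    have "sg (nxt k) = \<delta> (turn k) * sg (turn k)"
      using sg_mate[OF k(2)] mate_turn[of k] by (cases "mate (turn k) = turn k") (auto simp: \<delta>_def)
    then show ?thesis using esign_x k by simp
  qed
  then have "(\<Prod>k\<in>face i. esign T (x k)) = 
      (\<Prod>k\<in>face i. sg k) * (\<Prod>k\<in>face i. \<delta> (turn k) * sg (turn k))"
    by (simp add: prod.distrib)
  \<comment> \<open>As \<open>turn\<close> permutes the face, every \<open>sg k\<close> occurs twice
    and cancels; only the factors \<open>\<delta> k\<close> are left.\<close>
  also have "(\<Prod>k\<in>face i. \<delta> (turn k) * sg (turn k)) = (\<Prod>k\<in>turn ` face i. \<delta> k * sg k)"
    by (subst prod.reindex) (auto simp: inj_on_def dest: turn_inj)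
  also have "(\<Prod>k\<in>face i. sg k) * \<dots> = (\<Prod>k\<in>face i. sg k * sg k * \<delta> k)"
    by (simp add: turn_image_face prod.distrib)
  also have "\<dots> = (\<Prod>k\<in>face i. \<delta> k)"
    using sg_values face_less[OF assms] by (intro prod.cong) fastforce+
  also have "\<dots> = (-1) ^ card {k \<in> face i. mate k \<noteq> k}"
    unfolding \<delta>_def using finite_face by (simp add: prod.If_cases Int_def)
  finally show ?thesis .
qed

lemma balanced_face_iff:
  assumes "i < n" "i \<notin> doubled"
  shows "balanced T (x ` face i) \<longleftrightarrow> even (card {k \<in> face i. mate k \<noteq> k})"
proof -
  have "(\<Prod>e\<in>x ` face i. esign T e) = (-1) ^ card {k \<in> face i. mate k \<noteq> k}"
    using face_sign[OF assms(1)] by (simp add: prod.reindex[OF inj_on_x_face[OF assms]])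
  then show ?thesis by (simp add: balanced_def minus_one_power_iff)
qed

lemma eulerian_cycle_tree_T:
  assumes "signed_subgraph T G"
  shows "eulerian_cycle_tree G T block_cycles block_paths"
proof -
  have "balanced T C \<longleftrightarrow> 
      even (card (vertices_of T C \<inter> intersection_vertices T block_cycles block_paths))"
    if "C \<in> block_cycles" for C
  proof -
    obtain i where i: "i < n" "i \<notin> doubled" "C = x ` face i" using block_cyclesE \<open>C \<in> block_cycles\<close> by blast
    have "inj_on u {k \<in> face i. mate k \<noteq> k}" by (rule inj_on_subset[OF inj_on_face[OF i(1)]]) auto
    then show ?thesis
      using i by (simp add: cycle_intersection_vertices balanced_face_iff card_image)
  qed
  then show ?thesis using cycle_tree_T[OF assms] by (simp add: eulerian_cycle_tree_def)
qed

lemma no_sink_or_source: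
  assumes "v \<in> verts T"
  shows "\<not> sink T (edges T) \<tau> v \<and> \<not> source T (edges T) \<tau> v"
proof -
  obtain i where i: "i < n" "v = u i" using assms by (auto simp: verts_T)
  obtain j where j: "j < n" "nxt j = i" using nxt_surj i by blast
  have "endv T (x i) (b i) = v" "\<tau> (x i) (b i) = sg i" "x i \<in> edges T"
    using start_T sg_start x_in_edges i by auto
  moreover have "endv T (x j) (\<not> b j) = v" "\<tau> (x j) (\<not> b j) = - sg i" "x j \<in> edges T"
    using end_T sg_end x_in_edges i j by auto
  ultimately show ?thesis using sg_values[OF i(1)] unfolding sink_def source_def by force
qed

text \<open>At a matched visit \<open>k\<close> the face departs with sign \<open>sg k\<close>. It
  arrives by an edge after which the walk goes on from \<open>mate k\<close>, hence with sign
  \<open>- sg (mate k)\<close>, which is \<open>sg k\<close> again.\<close>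

lemma cycle_sink_or_source:
  assumes "C \<in> block_cycles" "v \<in> vertices_of T C" "cut_point T v"
  shows "sink T C \<tau> v \<or> source T C \<tau> v"
proof -
  obtain i where i: "i < n" "i \<notin> doubled" "C = x ` face i" using assms block_cyclesE by blast
  then obtain k where k: "k \<in> face i" "v = u k" using assms by (auto simp: vertices_of_face)
  then have kn: "k < n" using i face_less by simp
  then have mk: "mate k \<noteq> k" using assms cut_point_iff k by simp
  have "\<tau> e c = sg k" if e: "e \<in> C" "endv T e c = v" for e c
  proof -
    obtain a where a: "a \<in> face i" "e = x a" using e i by auto
    then have an: "a < n" using i face_less by simp
    then show ?thesis
    proof (cases rule: edge_end_cases[of a c])
      case 1
      then have "a = k" using inj_on_face[OF i(1)] a k e by (auto dest: inj_onD)
      then show ?thesis using 1 a sg_start an by simp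
    next
      case 2
      have "turn a \<in> face i" using a turn_in_face_iff by simp
      moreover have "u (turn a) = u k" using 2 a(2) k e by metis
      ultimately have "turn a = k" using inj_on_face[OF i(1)] k by (metis inj_onD)
      then have "nxt a = mate k" using mate_turn by metis
      then show ?thesis using 2 a sg_end[OF an] sg_mate[OF kn mk] by simp
    qed
  qed
  then show ?thesis using sg_values[OF kn] unfolding sink_def source_def by metis
qed

lemma cycle_tree_direction_T: "cycle_tree_direction T block_cycles \<tau>"
  using orientation no_sink_or_source cycle_sink_or_source by (simp add: cycle_tree_direction_def)

lemma card_occurrences: 
  assumes "k < n" shows "card {i. i < n \<and> x i = x k} = (if k \<in> doubled then 2 else 1)"
proof (cases "k \<in> doubled")
  case True
  have "i = k \<or> i = turn k" if "i < n" "x i = x k" for i 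
    using x_eqD[OF assms that(1)] that(2) by metis
  then have "{i. i < n \<and> x i = x k} = {k, turn k}"
    using doubled_turn(2)[OF True] turn_less[OF assms] assms by blast
  then show ?thesis using True doubled_turn(3)[OF True] by simp
next
  case False
  then have "i = k" if "i < n" "x i = x k" for i using x_eqD[OF assms that(1)] that(2) by metis
  then have "{i. i < n \<and> x i = x k} = {k}" using assms by blast
  then show ?thesis using False by simp
qed

text \<open>The indicator is the multiplicity of an edge in the walk, the common source of the usage
  counts and of the formula for the characteristic vector.\<close>

lemma tree_indicator_eq: 
  "tree_indicator block_cycles block_paths e = int (card {i. i < n \<and> x i = e})"
proof (cases "e \<in> edges T")
  case True
  then obtain k where k: "k < n" "e = x k" by (auto simp: edges_T)
  have "e \<in> x ` ({..<n} - doubled) \<longleftrightarrow> k \<notin> doubled" using x_eqD k by blast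
  moreover have "e \<in> x ` doubled \<longleftrightarrow> k \<in> doubled" 
    using x_eqD k doubled_less doubled_turn(1) by (metis imageE image_eqI)
  ultimately show ?thesis 
    using card_occurrences[OF k(1)] k
    by (simp add: tree_indicator_def block_cycle_edges_eq block_path_edges_eq)
next
  case False
  then have "{i. i < n \<and> x i = e} = {}" by (auto simp: edges_T)
  then have "card {i. i < n \<and> x i = e} = 0" by simp
  moreover have "e \<notin> x ` ({..<n} - doubled)" "e \<notin> x ` doubled" 
    using False doubled_less by (auto simp: edges_T)
  ultimately show ?thesis by (simp add: tree_indicator_def block_cycle_edges_eq block_path_edges_eq)
qed

end

section \<open>Minimal Eulerian walks\<close>

text \<open>
  A walk that leaves each vertex with the sign opposite to that of its arrival is a walk in the
  digraph on pairs of a vertex and a departing sign.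
\<close>

abbreviation tail_state :: "('v, 'e) signed_graph \<Rightarrow> ('e \<Rightarrow> bool \<Rightarrow> int) \<Rightarrow> 'e \<times> bool \<Rightarrow> 'v \<times> int" where
  "tail_state G \<tau> a \<equiv> (arc_start G a, \<tau> (fst a) (snd a))"

text \<open>The minus sign turns the sign of arrival into the sign with which the walk has to depart
  next.\<close>

abbreviation head_state :: "('v, 'e) signed_graph \<Rightarrow> ('e \<Rightarrow> bool \<Rightarrow> int) \<Rightarrow> 'e \<times> bool \<Rightarrow> 'v \<times> int" where
  "head_state G \<tau> a \<equiv> (arc_end G a, - \<tau> (fst a) (\<not> snd a))"

abbreviation coherent :: "('v, 'e) signed_graph \<Rightarrow> ('e \<Rightarrow> bool \<Rightarrow> int) \<Rightarrow> 
    'v \<times> int \<Rightarrow> ('e \<times> bool) list \<Rightarrow> 'v \<times> int \<Rightarrow> bool" where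
  "coherent G \<tau> \<equiv> chain (tail_state G \<tau>) (head_state G \<tau>)"

definition reverse_arc :: "'e \<times> bool \<Rightarrow> 'e \<times> bool" where
  "reverse_arc a = (fst a, \<not> snd a)"

definition opposite :: "'v \<times> int \<Rightarrow> 'v \<times> int" where
  "opposite s = (fst s, - snd s)"

lemma opposite_opposite: "opposite (opposite t) = t"
  by (simp add: opposite_def)

lemma coherent_reverse:
  "coherent G \<tau> s p t \<Longrightarrow> coherent G \<tau> (opposite t) (map reverse_arc (rev p)) (opposite s)"
  by (rule chain_reverse) (auto simp: reverse_arc_def opposite_def)

lemma coherent_chain_vertices: 
  "coherent G \<tau> s p t \<Longrightarrow> chain (arc_start G) (arc_end G) (fst s) p (fst t)"
  by (induction p arbitrary: s) auto

text \<open>Stated for one edge, the condition fits signs given only along a walk, and also the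
  signs \<open>\<omega> k\<close> at a single position.\<close>

definition local_orientation :: "('v, 'e) signed_graph \<Rightarrow> ('e \<Rightarrow> bool \<Rightarrow> int) \<Rightarrow> 'e \<Rightarrow> bool" where
  "local_orientation G \<tau> e \<longleftrightarrow> 
    (\<forall>c. \<tau> e c \<in> {1, -1}) \<and> \<tau> e False * \<tau> e True = - esign G e"

lemma local_orientation_flip:
  assumes "local_orientation G \<tau> e" shows "\<tau> e (\<not> c) = - esign G e * \<tau> e c"
proof -
  have *: "\<tau> e c * \<tau> e (\<not> c) = - esign G e"
    using assms by (cases c) (auto simp: local_orientation_def mult.commute)
  have "\<tau> e c = 1 \<or> \<tau> e c = -1" using assms by (auto simp: local_orientation_def)
  then have "\<tau> e c * \<tau> e c = 1" by (elim disjE) simp_all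
  then have "\<tau> e (\<not> c) = \<tau> e c * (\<tau> e c * \<tau> e (\<not> c))" unfolding mult.assoc[symmetric] by simp
  then show ?thesis unfolding * by (simp add: mult.commute)
qed

text \<open>Along an edge the sign of departure is multiplied by the sign of the edge. A closed
  coherent walk with departing signs \<open>1\<close> or \<open>-1\<close> thus has sign
  \<open>1\<close>.\<close>

lemma coherent_sign:
  assumes "coherent G \<tau> s p t" "\<forall>e\<in>fst ` set p. local_orientation G \<tau> e"
  shows "walk_sign G p * snd s = snd t"
  using assms
proof (induction p arbitrary: s)
  case (Cons a p)
  have "walk_sign G (a # p) * snd s = walk_sign G p * (esign G (fst a) * \<tau> (fst a) (snd a))"
    using Cons.prems by (auto simp: walk_sign_def walk_edges_def)
  also have "esign G (fst a) * \<tau> (fst a) (snd a) = - \<tau> (fst a) (\<not> snd a)"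
    using local_orientation_flip[of G \<tau> "fst a" "snd a"] Cons.prems by simp
  also have "walk_sign G p * \<dots> = snd t" using Cons.IH[of "head_state G \<tau> a"] Cons.prems by simp
  finally show ?case .
qed (simp add: walk_sign_def walk_edges_def)

text \<open>\<open>eulerian_walk\<close> quantifies over all directions, but a direction is
  determined by its first sign. So each one is \<open>\<tau>\<close> times a global sign
  \<open>\<kappa>\<close> and agrees on repeated edges as \<open>\<tau>\<close> does.\<close>

lemma closed_coherent_eulerian:
  assumes wf: "wf_signed_graph G" and ne: "p \<noteq> []" and edges: "fst ` set p \<subseteq> edges G"
    and \<tau>: "\<forall>e\<in>fst ` set p. local_orientation G \<tau> e" and p: "coherent G \<tau> s p s"
  shows "eulerian_walk G (fst s) p"
proof -
  have s: "tail_state G \<tau> (p ! 0) = s" using p unfolding chain_conv_nth[OF ne] by blast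
  have "hd p \<in> set p" "hd p = p ! 0" using ne by (auto simp: hd_conv_nth)
  then have e0: "fst (p ! 0) \<in> fst ` set p" by simp
  then have "fst s \<in> verts G" using s edges wf by (auto simp: wf_signed_graph_def)
  then have walk: "walk G (fst s) p (fst s)"
    using coherent_chain_vertices[OF p] edges by (simp add: walk_conv_chain)
  have "snd s = 1 \<or> snd s = -1" using bspec[OF \<tau> e0] s by (auto simp: local_orientation_def)
  then have sign: "walk_sign G p = 1" using coherent_sign[OF p \<tau>] by auto
  have "\<omega> i c = \<omega> j c"
    if \<omega>: "walk_direction G (fst s) p \<omega>" and ij: "i < length p" "j < length p" "fst (p ! i) = fst (p ! j)" for \<omega> i j c
  proof -
    define \<kappa> where "\<kappa> = \<omega> 0 (snd (p ! 0)) * \<tau> (fst (p ! 0)) (snd (p ! 0))"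
    have lo: "local_orientation G \<tau> (fst (p ! k))" if "k < length p" for k using \<tau> that by simp
    have lo': "local_orientation G (\<lambda>e. \<omega> k) (fst (p ! k))" if "k < length p" for k
      using \<omega> that by (simp add: walk_direction_def local_orientation_def)
    have all: "\<omega> k d = \<kappa> * \<tau> (fst (p ! k)) d" 
      if "k < length p" "\<omega> k (snd (p ! k)) = \<kappa> * \<tau> (fst (p ! k)) (snd (p ! k))" for k d
      using local_orientation_flip[OF lo[OF that(1)], of "snd (p ! k)"] 
        local_orientation_flip[OF lo'[OF that(1)], of "snd (p ! k)"] that(2)
      by (cases "d = snd (p ! k)") (auto simp: algebra_simps)
    have start: "k < length p \<Longrightarrow> \<omega> k (snd (p ! k)) = \<kappa> * \<tau> (fst (p ! k)) (snd (p ! k))" for k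
    proof (induction k)
      case 0
      have "\<tau> (fst (p ! 0)) (snd (p ! 0)) * \<tau> (fst (p ! 0)) (snd (p ! 0)) = 1"
        using lo[OF 0] by (auto simp: local_orientation_def) (metis insertE mult_1 mult_minus1 minus_minus singletonD)
      then show ?case by (simp add: \<kappa>_def mult.assoc)
    next
      case (Suc k)
      have "head_state G \<tau> (p ! k) = tail_state G \<tau> (p ! Suc k)"
        using p Suc.prems unfolding chain_conv_nth[OF ne] by blast
      then have "- \<tau> (fst (p ! k)) (\<not> snd (p ! k)) = \<tau> (fst (p ! Suc k)) (snd (p ! Suc k))" by simp
      moreover have "\<omega> k (\<not> snd (p ! k)) + \<omega> (Suc k) (snd (p ! Suc k)) = 0"
        using \<omega> Suc.prems by (simp add: walk_direction_def)
      moreover have "\<omega> k (\<not> snd (p ! k)) = \<kappa> * \<tau> (fst (p ! k)) (\<not> snd (p ! k))"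
        using all[of k] Suc by simp
      ultimately show ?case by (metis add_eq_0_iff minus_mult_right)
    qed
    show ?thesis using all[OF ij(1) start[OF ij(1)]] all[OF ij(2) start[OF ij(2)]] ij(3) by simp
  qed
  then show ?thesis using ne walk sign unfolding eulerian_walk_def by blast
qed

lemma drop_split: 
  assumes "k \<le> j" "j \<le> length xs" 
  shows "drop k xs = drop k (take j xs) @ drop j xs"
proof -
  have "drop k (take j xs @ drop j xs) = drop k (take j xs) @ drop j xs"
    using assms by (subst drop_append) (simp add: min_absorb2)
  then show ?thesis by simp
qed

text \<open>Minimality is required only against walks coherent for the same \<open>\<tau>\<close>.
  It compares edges without their directions, so pieces of \<open>W\<close> may be reversed.\<close>

locale minimal_coherent_walk =
  fixes G :: "('v, 'e) signed_graph" and W :: "('e \<times> bool) list" 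
    and \<tau> :: "'e \<Rightarrow> bool \<Rightarrow> int" and s :: "'v \<times> int"
  assumes wf: "wf_signed_graph G" and ne: "W \<noteq> []" and edges_W: "fst ` set W \<subseteq> edges G"
    and \<tau>: "\<forall>e\<in>fst ` set W. local_orientation G \<tau> e"
    and \<tau>_outside: "e \<notin> fst ` set W \<Longrightarrow> \<tau> e c = 0"
    and coherent: "coherent G \<tau> s W s"
    and minimal: "\<lbrakk>p \<noteq> []; coherent G \<tau> t p t\<rbrakk> \<Longrightarrow> \<not> image_mset fst (mset p) \<subset># image_mset fst (mset W)"
begin

abbreviation state :: "nat \<Rightarrow> 'v \<times> int" where
  "state i \<equiv> tail_state G \<tau> (W ! i)"

lemma mset_segment:
  assumes "i < j" "j \<le> length W"
  shows "mset W = mset (take i W) + mset (drop i (take j W)) + mset (drop j W)"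
proof -
  have "mset W = mset (take i W @ drop i W)" by simp
  also have "\<dots> = mset (take i W) + mset (drop i (take j W)) + mset (drop j W)"
    using drop_split[of i j W] assms by (simp only: mset_append) (simp add: add.assoc)
  finally show ?thesis .
qed

lemma states_distinct:
  assumes "i < j" "j < length W" shows "state i \<noteq> state j"
proof
  assume eq: "state i = state j"
  let ?p = "drop i (take j W)"
  have closed: "coherent G \<tau> (state i) ?p (state i)" using chain_segment[OF coherent assms] eq by simp
  have "?p \<noteq> []" using assms by simp
  have "mset ?p \<subseteq># mset W" using mset_segment[of i j] assms by simp
  moreover have "mset ?p \<noteq> mset W" 
  proof
    assume "mset ?p = mset W"
    then have "length ?p = length W" by (rule mset_eq_length)
    then show False using assms by simp
  qed
  ultimately have "image_mset fst (mset ?p) \<subset># image_mset fst (mset W)"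
    by (intro image_mset_subset_mono) (simp add: subset_mset.less_le)
  with closed \<open>?p \<noteq> []\<close> show False using minimal by blast
qed

lemma state_values: "i < length W \<Longrightarrow> snd (state i) = 1 \<or> snd (state i) = -1"
  using \<tau> by (auto simp: local_orientation_def)

lemma state_opposite:
  assumes "i < length W" "j < length W" "i \<noteq> j" "fst (state i) = fst (state j)"
  shows "state j = opposite (state i)"
proof -
  have "state i \<noteq> state j" using states_distinct[of i j] states_distinct[of j i] assms by (metis nat_neq_iff)
  then show ?thesis using state_values[OF assms(1)] state_values[OF assms(2)] assms(4)
    by (auto simp: opposite_def)
qed

text \<open>
  If the visits of two vertices interlace, reversing one arc of the closed walk between the visits
  of the first vertex makes the two visits of the second one agree in sign.
\<close>

lemma states_noncrossing:
  assumes "i < k" "k < j" "j < l" "l < length W" "fst (state i) = fst (state j)" "fst (state k) = fst (state l)"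
  shows False
proof -
  let ?A = "drop i (take k W)" and ?C = "drop j (take l W)"
  \<comment> \<open>The reversed \<open>?A\<close> leads from \<open>opposite (state k)\<close>,
    which is \<open>state l\<close>, to \<open>opposite (state i)\<close>, which is
    \<open>state j\<close>; then \<open>?C\<close> leads back to \<open>state l\<close>. The stretch
    from \<open>k\<close> to \<open>j\<close> is left out, so the walk is smaller.\<close>
  let ?p = "map reverse_arc (rev ?A) @ ?C"
  have "coherent G \<tau> (opposite (state k)) (map reverse_arc (rev ?A)) (opposite (state i))"
    by (rule coherent_reverse[OF chain_segment[OF coherent]]) (use assms in auto)
  moreover have "coherent G \<tau> (state j) ?C (state l)"
    by (rule chain_segment[OF coherent]) (use assms in auto)
  moreover have "opposite (state i) = state j" "opposite (state k) = state l"
    using state_opposite[of i j] state_opposite[of k l] assms by auto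
  ultimately have "coherent G \<tau> (state l) ?p (state l)" by (auto intro: chain_append)
  moreover have "?p \<noteq> []" using assms by simp
  moreover have "image_mset fst (mset ?p) \<subset># image_mset fst (mset W)"
  proof -
    have W: "mset W = mset (take i W) + mset ?A + mset (drop k W)" 
      using mset_segment[of i k] assms by simp
    have "drop k W = drop k (take j W) @ drop j W" by (rule drop_split) (use assms in auto)
    moreover have "drop j W = ?C @ drop l W" by (rule drop_split) (use assms in auto)
    ultimately have "mset (drop k W) = mset (drop k (take j W)) + (mset ?C + mset (drop l W))" by simp
    moreover have "drop k (take j W) \<noteq> []" using assms by simp
    ultimately have "mset ?A + mset ?C \<subset># mset W"
      unfolding W by (simp add: subset_mset.less_le)
    then have "image_mset fst (mset ?A + mset ?C) \<subset># image_mset fst (mset W)"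
      by (rule image_mset_subset_mono)
    moreover have "image_mset fst (mset ?p) = image_mset fst (mset ?A + mset ?C)"
      by (simp add: reverse_arc_def image_mset.compositionality comp_def)
    ultimately show ?thesis by (simp only:)
  qed
  ultimately show False using minimal[of ?p "state l"] by blast
qed

section \<open>The minimal walk as a noncrossing cyclic sequence\<close>

lemma noncrossing_cyclic_W: "noncrossing_cyclic (length W) (\<lambda>i. arc_start G (W ! i))"
proof
  show "0 < length W" using ne by simp
next
  fix i j k
  assume *: "i < length W" "j < length W" "k < length W"
    "arc_start G (W ! i) = arc_start G (W ! j)" "arc_start G (W ! j) = arc_start G (W ! k)"
  show "i = j \<or> j = k \<or> i = k"
  proof (rule ccontr)
    assume "\<not> (i = j \<or> j = k \<or> i = k)"
    then have "state j = opposite (state i)" "state k = opposite (state i)" "state k = opposite (state j)"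
      using * state_opposite[of i j] state_opposite[of i k] state_opposite[of j k] by auto
    then have "state i = opposite (state i)" by (metis opposite_opposite)
    then show False using state_values[OF *(1)] by (auto simp: opposite_def)
  qed
next
  fix i k j l
  assume "i < k" "k < j" "j < l" "l < length W"
    "arc_start G (W ! i) = arc_start G (W ! j)" "arc_start G (W ! k) = arc_start G (W ! l)"
  then show False using states_noncrossing[of i k j l] by simp
qed

sublocale noncrossing_cyclic "length W" "\<lambda>i. arc_start G (W ! i)"
  by (rule noncrossing_cyclic_W)

lemma head_state_nxt: "i < length W \<Longrightarrow> head_state G \<tau> (W ! i) = state (nxt i)"
  using closed_chain_nth[OF coherent] by (simp add: nxt_eq_mod)

text \<open>Traversing an edge twice in the same direction would repeat a state. In opposite
  directions, the first traversal ends in the state opposite to the one where the second begins: the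
  same vertex, but another position.\<close>

sublocale doubled_cyclic "length W" "\<lambda>i. arc_start G (W ! i)" "\<lambda>i. fst (W ! i)"
proof
  fix i j
  assume *: "i < length W" "j < length W" "i \<noteq> j" "fst (W ! i) = fst (W ! j)"
  have "snd (W ! i) \<noteq> snd (W ! j)"
  proof
    assume "snd (W ! i) = snd (W ! j)"
    then have "state i = state j" using * by simp
    then show False using states_distinct[of i j] states_distinct[of j i] * by (metis nat_neq_iff)
  qed
  then have "W ! j = (fst (W ! i), \<not> snd (W ! i))" using * by (simp add: prod_eq_iff)
  then have "head_state G \<tau> (W ! i) = opposite (state j)" by (simp add: opposite_def)
  then have "state (nxt i) = opposite (state j)" using head_state_nxt[OF *(1)] by simp
  then show "arc_start G (W ! nxt i) = arc_start G (W ! j) \<and> nxt i \<noteq> j"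
    using state_values[OF *(2)] by (auto simp: opposite_def)
qed

abbreviation T :: "('v, 'e) signed_graph" where
  "T \<equiv> walk_subgraph G (fst s) W"

lemma set_W: "set W = (!) W ` {..<length W}"
  by (auto simp: set_conv_nth)

lemma edges_W_subgraph: "edges T = (\<lambda>i. fst (W ! i)) ` {..<length W}"
  by (simp add: walk_subgraph_def walk_edges_def set_W image_image)

lemma arc_ends_in_verts:
  assumes "i < length W" shows "endv G (fst (W ! i)) c \<in> verts G"
proof -
  have "fst (W ! i) \<in> edges G" using edges_W nth_mem[OF assms] by blast
  then show ?thesis using wf by (simp add: wf_signed_graph_def)
qed

lemma verts_W_subgraph: "verts T = (\<lambda>i. arc_start G (W ! i)) ` {..<length W}"
proof -
  let ?u = "\<lambda>i. arc_start G (W ! i)"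
  have "verts T = insert (fst s) ((\<lambda>i. arc_end G (W ! i)) ` {..<length W})"
    by (simp add: walk_subgraph_def walk_verts_eq set_W image_image)
  also have "(\<lambda>i. arc_end G (W ! i)) ` {..<length W} = (\<lambda>i. ?u (nxt i)) ` {..<length W}"
    using head_state_nxt by auto
  also have "\<dots> = ?u ` {..<length W}"
    unfolding image_image[of ?u nxt, symmetric] permutes_image[OF nxt_permutes] ..
  finally have "verts T = insert (fst s) (?u ` {..<length W})" .
  moreover have "?u 0 = fst s" using coherent unfolding chain_conv_nth[OF ne] by auto
  then have "fst s \<in> ?u ` {..<length W}" using ne by (intro image_eqI[of _ _ 0]) auto
  ultimately show ?thesis by (simp only: insert_absorb)
qed

lemma signed_subgraph_T: "signed_subgraph T G"
proof -
  have "verts T \<subseteq> verts G" using verts_W_subgraph arc_ends_in_verts by auto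
  moreover have "edges T \<subseteq> edges G" using edges_W by (auto simp: walk_subgraph_def walk_edges_def)
  moreover have "endv G e c \<in> verts T" if "e \<in> edges T" for e c
  proof -
    obtain i where i: "i < length W" "e = fst (W ! i)" using \<open>e \<in> edges T\<close> unfolding edges_W_subgraph by blast
    have "endv G e c = arc_start G (W ! i) \<or> endv G e c = arc_end G (W ! i)"
      unfolding i(2) by (cases "c = snd (W ! i)") auto
    then show ?thesis using head_state_nxt[OF i(1)] i(1) by (auto simp: verts_W_subgraph)
  qed
  ultimately show ?thesis
    using wf by (auto simp: signed_subgraph_def wf_signed_graph_def walk_subgraph_def walk_edges_def)
qed

sublocale dir: directed_noncrossing_walk "length W" "\<lambda>i. arc_start G (W ! i)" "\<lambda>i. fst (W ! i)" T
  "\<lambda>i. snd (W ! i)" \<tau> "\<lambda>i. snd (state i)"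
proof
  show "wf_signed_graph T" using signed_subgraph_T by (simp add: signed_subgraph_def)
  show "verts T = (\<lambda>i. arc_start G (W ! i)) ` {..<length W}" by (rule verts_W_subgraph)
  show "edges T = (\<lambda>i. fst (W ! i)) ` {..<length W}" by (rule edges_W_subgraph)
  show "orientation T \<tau>"
    using \<tau> \<tau>_outside by (auto simp: orientation_def local_orientation_def walk_subgraph_def walk_edges_def)
next
  fix i assume i: "i < length W"
  show "arc_start T (W ! i) = arc_start G (W ! i)" by (simp add: walk_subgraph_def)
  show "arc_end T (W ! i) = arc_start G (W ! nxt i)" "\<tau> (fst (W ! i)) (\<not> snd (W ! i)) = - snd (state (nxt i))"
    using head_state_nxt[OF i] by (auto simp: walk_subgraph_def)
  show "\<tau> (fst (W ! i)) (snd (W ! i)) = snd (state i)" by simp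
  assume "mate i \<noteq> i"
  moreover have "fst (state i) = fst (state (mate i))" using u_mate[of i] by simp
  ultimately have "state (mate i) = opposite (state i)" using i mate_less by (intro state_opposite) auto
  then show "snd (state (mate i)) = - snd (state i)" by (simp add: opposite_def)
qed

lemma count_walk_edges: "count (mset (walk_edges W)) e = card {i. i < length W \<and> fst (W ! i) = e}"
proof -
  have "count (mset (walk_edges W)) e = length (filter ((=) e) (walk_edges W))"
    by (metis length_replicate replicate_count_mset_eq_filter_eq)
  also have "\<dots> = card {i. i < length W \<and> fst (W ! i) = e}"
    unfolding length_filter_conv_card by (rule arg_cong[of _ _ card]) (auto simp: walk_edges_def)
  finally show ?thesis .
qed

end

theorem theorem3p5:
  fixes G :: "('v, 'e) signed_graph"
    and \<epsilon> :: "'e \<Rightarrow> bool \<Rightarrow> int"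
    and u :: 'v
    and W :: "('e \<times> bool) list"
    and \<omega> :: "nat \<Rightarrow> bool \<Rightarrow> int"
  assumes "wf_signed_graph G"
    and "orientation G \<epsilon>"
    and "minimal_eulerian_walk G u W"
    and "walk_direction G u W \<omega>"
  defines "T \<equiv> walk_subgraph G u W"
  shows "\<exists>\<C> \<P> \<tau>.
    eulerian_cycle_tree G T \<C> \<P> \<and>
    (\<forall>x\<in>block_cycle_edges \<C>. count (mset (walk_edges W)) x = 1) \<and>
    (\<forall>x\<in>block_path_edges \<P>. count (mset (walk_edges W)) x = 2) \<and>
    induces_orientation W \<omega> \<tau> \<and>
    cycle_tree_direction T \<C> \<tau> \<and>
    (\<forall>x\<in>edges G. char_vector \<epsilon> W \<omega> x = coupling G \<epsilon> T \<tau> x * tree_indicator \<C> \<P> x)"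
proof -
  have W: "W \<noteq> []" "walk G u W u" 
    and same: "\<And>i j c. i < length W \<Longrightarrow> j < length W \<Longrightarrow> fst (W ! i) = fst (W ! j) \<Longrightarrow> \<omega> i c = \<omega> j c"
    and min: "\<And>u' p'. eulerian_walk G u' p' \<Longrightarrow> \<not> mset (walk_edges p') \<subset># mset (walk_edges W)"
    using assms(3,4) unfolding minimal_eulerian_walk_def eulerian_walk_def by blast+
  \<comment> \<open>Any occurrence may be chosen, since \<open>\<omega>\<close> agrees on all of
    them; the value 0 elsewhere is what \<open>orientation\<close> demands for the subgraph.\<close>
  define \<tau> where "\<tau> e c =
    (if e \<in> fst ` set W then \<omega> (SOME i. i < length W \<and> fst (W ! i) = e) c else 0)" for e c
  have \<tau>_\<omega>: "\<tau> (fst (W ! i)) c = \<omega> i c" if i: "i < length W" for i c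
  proof -
    let ?j = "SOME j. j < length W \<and> fst (W ! j) = fst (W ! i)"
    have "?j < length W \<and> fst (W ! ?j) = fst (W ! i)" by (rule someI[of _ i]) (use i in simp)
    then show ?thesis using same[of ?j i c] i by (simp add: \<tau>_def)
  qed
  have local: "local_orientation G \<tau> e" if "e \<in> fst ` set W" for e
  proof -
    obtain i where "i < length W" "e = fst (W ! i)"
      using \<open>e \<in> fst ` set W\<close> by (metis imageE in_set_conv_nth)
    then show ?thesis using assms(4) \<tau>_\<omega> by (simp add: local_orientation_def walk_direction_def)
  qed
  have edges: "fst ` set W \<subseteq> edges G" and chain: "chain (arc_start G) (arc_end G) u W u"
    using W by (auto simp: walk_conv_chain)
  define s where "s = tail_state G \<tau> (W ! 0)"
  have start: "fst s = u" using chain by (simp add: chain_conv_nth W s_def)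
  have coherent: "coherent G \<tau> s W s"
    unfolding chain_conv_nth[OF W(1)] s_def
  proof (intro conjI allI impI)
    fix k assume k: "Suc k < length W"
    then have "\<omega> k (\<not> snd (W ! k)) + \<omega> (Suc k) (snd (W ! Suc k)) = 0"
      using assms(4) by (simp add: walk_direction_def)
    moreover have "arc_end G (W ! k) = arc_start G (W ! Suc k)"
      using chain k by (simp add: chain_conv_nth W)
    ultimately show "head_state G \<tau> (W ! k) = tail_state G \<tau> (W ! Suc k)"
      using \<tau>_\<omega> k by (simp add: add_eq_0_iff)
  next
    have "\<omega> 0 (snd (W ! 0)) + \<omega> (length W - 1) (\<not> snd (W ! (length W - 1))) = 0"
      using assms(4) W by (simp add: walk_direction_def)
    moreover have "arc_end G (last W) = arc_start G (W ! 0)" using chain by (simp add: chain_conv_nth W)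
    ultimately show "head_state G \<tau> (last W) = tail_state G \<tau> (W ! 0)"
      using \<tau>_\<omega> W by (simp add: last_conv_nth add_eq_0_iff)
  qed simp
  interpret minimal_coherent_walk G W \<tau> s
  proof
    show "wf_signed_graph G" "W \<noteq> []" "fst ` set W \<subseteq> edges G" "coherent G \<tau> s W s"
      by (fact assms(1) W(1) edges coherent)+
    show "\<forall>e\<in>fst ` set W. local_orientation G \<tau> e" using local by blast
    show "\<tau> e c = 0" if "e \<notin> fst ` set W" for e c using that by (simp add: \<tau>_def)
    show "\<not> image_mset fst (mset p) \<subset># image_mset fst (mset W)"
      if p: "p \<noteq> []" "coherent G \<tau> t p t" for p t
    proof
      assume sub: "image_mset fst (mset p) \<subset># image_mset fst (mset W)"
      \<comment> \<open>A walk with fewer edges stays where \<open>\<tau>\<close> is an orientation;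
        being closed and coherent, it is Eulerian.\<close>
      then have "fst ` set p \<subseteq> fst ` set W" 
        by (metis set_image_mset set_mset_mono set_mset_mset subset_mset.less_imp_le)
      then have "eulerian_walk G (fst t) p"
        using closed_coherent_eulerian[OF assms(1) p(1) _ _ p(2)] edges local by blast
      then show False using min sub by (simp add: walk_edges_def)
    qed
  qed
  have T: "T = walk_subgraph G (fst s) W" using start by (simp add: T_def)
  let ?C = "dir.block_cycles" and ?P = "dir.block_paths"
  have count: "int (count (mset (walk_edges W)) e) = tree_indicator ?C ?P e" for e
    unfolding dir.tree_indicator_eq count_walk_edges ..
  have "char_vector \<epsilon> W \<omega> e = coupling G \<epsilon> T \<tau> e * tree_indicator ?C ?P e" if e: "e \<in> edges G" for e
  proof -
    \<comment> \<open>All occurrences of an edge contribute the same coupling, so the sum is the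
      coupling times the multiplicity.\<close>
    have "char_vector \<epsilon> W \<omega> e = (\<Sum>i | i < length W \<and> fst (W ! i) = e. coupling G \<epsilon> T \<tau> e)"
      unfolding char_vector_def
    proof (rule sum.cong)
      fix i assume "i \<in> {i. i < length W \<and> fst (W ! i) = e}"
      then have i: "i < length W" "fst (W ! i) = e" by auto
      then have "e \<in> edges T" "esign G e = esign T e" 
        by (auto simp: T_def walk_subgraph_def walk_edges_def)
      then show "\<epsilon> e (snd (W ! i)) * \<omega> i (snd (W ! i)) = coupling G \<epsilon> T \<tau> e"
        using coupling_eq[OF assms(2) dir.orientation[folded T] e, of "snd (W ! i)"] \<tau>_\<omega>[OF i(1)] i(2) by simp
    qed simp
    then show ?thesis using dir.tree_indicator_eq[of e] by simp
  qed
  moreover have "count (mset (walk_edges W)) e = 1" if "e \<in> block_cycle_edges ?C" for e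
    using count[of e] that by (simp add: tree_indicator_def)
  moreover have "count (mset (walk_edges W)) e = 2" if "e \<in> block_path_edges ?P" for e
  proof -
    have "e \<notin> block_cycle_edges ?C" using that dir.block_edges_disjoint by blast
    then show ?thesis using count[of e] that by (simp add: tree_indicator_def)
  qed
  moreover have "induces_orientation W \<omega> \<tau>" using \<tau>_\<omega> by (simp add: induces_orientation_def)
  moreover have "eulerian_cycle_tree G T ?C ?P" "cycle_tree_direction T ?C \<tau>"
    unfolding T by (rule dir.eulerian_cycle_tree_T[OF signed_subgraph_T] dir.cycle_tree_direction_T)+
  ultimately show ?thesis by blast
qed

end
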